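(* Let $X$ be a complex Banach space and $T\in\mathcal{B}(X)$. Then $\sigma_{gD}(T)=\sigma_{gD\mathcal{W}}(T)$ if and only if $T$ and $T^*$ have the SVEP at every $\lambda\notin\sigma_{gD\mathcal{W}}(T)$.
   Context: $\mathcal{B}(X)$ is the algebra of bounded linear operators on $X$; $T^*$ is the adjoint of $T$ acting on the dual space $X^*$. A Weyl operator is a Fredholm operator of index zero. $T$ is generalized Drazin invertible (resp. pseudo B-Weyl) if there are closed $T$-invariant subspaces $X_1,X_2$ with $X=X_1\oplus X_2$ such that $T_{|X_1}$ is invertible (resp. Weyl) and $T_{|X_2}$ is quasi-nilpotent. $\sigma_{gD}(T)$ (resp. $\sigma_{gD\mathcal{W}}(T)$) is the set of $\lambda\in\mathbb{C}$ such that $T-\lambda I$ is not generalized Drazin invertible (resp. not pseudo B-Weyl). An operator $S$ on a complex Banach space $Y$ has SVEP (the single valued extension property) at $\lambda_0\in\mathbb{C}$ if for every connected open neighbourhood $U$ of $\lambda_0$ the only analytic function $f:U\to Y$ with $(S-zI)f(z)=0$ for all $z\in U$ is $f\equiv 0$. *)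

theory Defs
  imports "HOL-Analysis.Analysis"
begin

section \<open>Complex Banach spaces\<close>

class complex_banach = banach +
  fixes scaleC :: "complex \<Rightarrow> 'a \<Rightarrow> 'a" (infixr \<open>*\<^sub>C\<close> 75)
  assumes scaleC_add_right: "c *\<^sub>C (x + y) = c *\<^sub>C x + c *\<^sub>C y"
    and scaleC_add_left: "(c + d) *\<^sub>C x = c *\<^sub>C x + d *\<^sub>C x"
    and scaleC_scaleC: "c *\<^sub>C (d *\<^sub>C x) = (c * d) *\<^sub>C x"
    and scaleC_of_real: "complex_of_real r *\<^sub>C x = r *\<^sub>R x"
    and norm_scaleC: "norm (c *\<^sub>C x) = cmod c * norm x"

lemma scaleC_one: "1 *\<^sub>C x = (x :: 'a::complex_banach)"
  using scaleC_of_real[of 1 x] by simp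

instantiation complex :: complex_banach
begin

definition scaleC_complex :: "complex \<Rightarrow> complex \<Rightarrow> complex"
  where "scaleC_complex c x = c * x"

instance
  by standard
    (simp_all add: scaleC_complex_def algebra_simps scaleR_conv_of_real norm_mult)

end

global_interpretation complex_vector: vector_space "scaleC :: complex \<Rightarrow> 'a \<Rightarrow> 'a::complex_banach"
  defines csubspace = complex_vector.subspace
    and cspan = complex_vector.span
    and cdependent = complex_vector.dependent
    and cdim = complex_vector.dim
  by standard (simp_all add: scaleC_add_right scaleC_add_left scaleC_scaleC scaleC_one)

abbreviation "cindependent S \<equiv> \<not> cdependent S"

lemma bounded_bilinear_scaleC:
  "bounded_bilinear (scaleC :: complex \<Rightarrow> 'a \<Rightarrow> 'a::complex_banach)"
proof
  fix a a' :: complex and b b' :: 'a and r :: real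
  show "(a + a') *\<^sub>C b = a *\<^sub>C b + a' *\<^sub>C b" "a *\<^sub>C (b + b') = a *\<^sub>C b + a *\<^sub>C b'"
    by (simp_all add: scaleC_add_left scaleC_add_right)
  show "(r *\<^sub>R a) *\<^sub>C b = r *\<^sub>R a *\<^sub>C b" "a *\<^sub>C (r *\<^sub>R b) = r *\<^sub>R a *\<^sub>C b"
    by (simp_all flip: scaleC_of_real add: scaleC_scaleC)
      (simp_all add: scaleC_complex_def mult.commute)
  show "\<exists>K. \<forall>a (b::'a). norm (a *\<^sub>C b) \<le> norm a * norm b * K"
    by (intro exI[of _ 1]) (simp add: norm_scaleC)
qed


section \<open>Bounded complex-linear operators, and the dual space\<close>

typedef (overloaded) ('a, 'b) cblinfun (\<open>(_ \<Rightarrow>\<^sub>\<complex> /_)\<close> [22, 21] 21) =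
  "{f :: 'a::complex_banach \<Rightarrow>\<^sub>L 'b::complex_banach. \<forall>c x. f (c *\<^sub>C x) = c *\<^sub>C f x}"
  morphisms blinfun_of_cblinfun CBlinfun
  by (rule exI[of _ 0]) simp

setup_lifting type_definition_cblinfun

lift_definition cblinfun_apply :: "('a::complex_banach \<Rightarrow>\<^sub>\<complex> 'b::complex_banach) \<Rightarrow> 'a \<Rightarrow> 'b"
  is blinfun_apply .

declare [[coercion cblinfun_apply]]

instantiation cblinfun :: (complex_banach, complex_banach) real_normed_vector
begin

lift_definition norm_cblinfun :: "('a \<Rightarrow>\<^sub>\<complex> 'b) \<Rightarrow> real" is norm .

lift_definition zero_cblinfun :: "'a \<Rightarrow>\<^sub>\<complex> 'b" is 0 by simp

lift_definition plus_cblinfun :: "('a \<Rightarrow>\<^sub>\<complex> 'b) \<Rightarrow> ('a \<Rightarrow>\<^sub>\<complex> 'b) \<Rightarrow> ('a \<Rightarrow>\<^sub>\<complex> 'b)" is "(+)"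
  by (simp add: blinfun.add_left complex_vector.scale_right_distrib)

lift_definition minus_cblinfun :: "('a \<Rightarrow>\<^sub>\<complex> 'b) \<Rightarrow> ('a \<Rightarrow>\<^sub>\<complex> 'b) \<Rightarrow> ('a \<Rightarrow>\<^sub>\<complex> 'b)" is "(-)"
  by (simp add: blinfun.diff_left complex_vector.scale_right_diff_distrib)

lift_definition uminus_cblinfun :: "('a \<Rightarrow>\<^sub>\<complex> 'b) \<Rightarrow> ('a \<Rightarrow>\<^sub>\<complex> 'b)" is "uminus"
  by (simp add: blinfun.minus_left)

lift_definition scaleR_cblinfun :: "real \<Rightarrow> ('a \<Rightarrow>\<^sub>\<complex> 'b) \<Rightarrow> ('a \<Rightarrow>\<^sub>\<complex> 'b)" is "scaleR"
  by (simp add: blinfun.scaleR_left scaleC_scaleC mult.commute flip: scaleC_of_real)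

definition dist_cblinfun :: "('a \<Rightarrow>\<^sub>\<complex> 'b) \<Rightarrow> ('a \<Rightarrow>\<^sub>\<complex> 'b) \<Rightarrow> real"
  where "dist_cblinfun a b = norm (a - b)"

definition sgn_cblinfun :: "('a \<Rightarrow>\<^sub>\<complex> 'b) \<Rightarrow> ('a \<Rightarrow>\<^sub>\<complex> 'b)"
  where "sgn_cblinfun x = scaleR (inverse (norm x)) x"

definition uniformity_cblinfun :: "(('a \<Rightarrow>\<^sub>\<complex> 'b) \<times> ('a \<Rightarrow>\<^sub>\<complex> 'b)) filter"
  where [code del]: "uniformity_cblinfun = (INF e\<in>{0 <..}. principal {(x, y). dist x y < e})"

definition open_cblinfun :: "('a \<Rightarrow>\<^sub>\<complex> 'b) set \<Rightarrow> bool"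
  where [code del]: "open_cblinfun S = (\<forall>x\<in>S. \<forall>\<^sub>F (x', y) in uniformity. x' = x \<longrightarrow> y \<in> S)"

instance
  apply standard
  unfolding dist_cblinfun_def open_cblinfun_def sgn_cblinfun_def uniformity_cblinfun_def
  apply (rule refl | (transfer, force simp: norm_triangle_ineq algebra_simps))+
  done

end

instantiation cblinfun :: (complex_banach, complex_banach) complex_banach
begin

lift_definition scaleC_cblinfun :: "complex \<Rightarrow> ('a \<Rightarrow>\<^sub>\<complex> 'b) \<Rightarrow> ('a \<Rightarrow>\<^sub>\<complex> 'b)"
  is "\<lambda>c f. blinfun_compose (Blinfun (scaleC c)) f"
  by (simp add: bounded_linear_Blinfun_apply
      bounded_bilinear.bounded_linear_right[OF bounded_bilinear_scaleC] scaleC_scaleC mult.commute)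

instance
proof
  note B = bounded_linear_Blinfun_apply
      [OF bounded_bilinear.bounded_linear_right[OF bounded_bilinear_scaleC]]
  fix c d :: complex and x y :: "'a \<Rightarrow>\<^sub>\<complex> 'b" and r :: real
  show "c *\<^sub>C (x + y) = c *\<^sub>C x + c *\<^sub>C y"
    by transfer (rule blinfun_eqI, simp add: B blinfun.add_left scaleC_add_right)
  show "(c + d) *\<^sub>C x = c *\<^sub>C x + d *\<^sub>C x"
    by transfer (rule blinfun_eqI, simp add: B blinfun.add_left scaleC_add_left)
  show "c *\<^sub>C (d *\<^sub>C x) = (c * d) *\<^sub>C x"
    by transfer (rule blinfun_eqI, simp add: B scaleC_scaleC)
  show "complex_of_real r *\<^sub>C x = r *\<^sub>R x"
    by transfer (rule blinfun_eqI, simp add: B scaleC_of_real blinfun.scaleR_left)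
  have le: "norm (c *\<^sub>C x) \<le> cmod c * norm x" for c and x :: "'a \<Rightarrow>\<^sub>\<complex> 'b"
  proof (transfer, rule norm_blinfun_bound)
    fix c :: complex and x :: "'a \<Rightarrow>\<^sub>L 'b" and v
    show "norm (blinfun_apply (Blinfun (scaleC c) o\<^sub>L x) v) \<le> cmod c * norm x * norm v"
      using mult_left_mono[OF norm_blinfun[of x v], of "cmod c"]
      by (simp add: B norm_scaleC mult.assoc)
  qed simp
  show "norm (c *\<^sub>C x) = cmod c * norm x"
  proof (cases "c = 0")
    case True
    then show ?thesis using le[of 0 x] by simp
  next
    case False
    have "inverse c *\<^sub>C (c *\<^sub>C x) = x"
      using False by transfer (rule blinfun_eqI, simp add: B scaleC_scaleC scaleC_one)
    then have "norm x \<le> cmod (inverse c) * norm (c *\<^sub>C x)"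
      using le[of "inverse c" "c *\<^sub>C x"] by simp
    then have "cmod c * norm x \<le> norm (c *\<^sub>C x)"
      using False unfolding norm_inverse by (simp add: field_simps)
    then show ?thesis using le[of c x] by linarith
  qed
next
  fix X :: "nat \<Rightarrow> 'a \<Rightarrow>\<^sub>\<complex> 'b"
  assume "Cauchy X"
  then have "Cauchy (\<lambda>n. blinfun_of_cblinfun (X n))"
    unfolding Cauchy_def dist_norm
    by (simp flip: minus_cblinfun.rep_eq norm_cblinfun.rep_eq)
  then obtain L where L: "(\<lambda>n. blinfun_of_cblinfun (X n)) \<longlonglongrightarrow> L"
    using Cauchy_convergent_iff convergent_def by blast
  have lim: "(\<lambda>n. blinfun_apply (blinfun_of_cblinfun (X n)) v) \<longlonglongrightarrow> blinfun_apply L v" for v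
    using blinfun.tendsto[OF L tendsto_const] .
  have "blinfun_apply L (c *\<^sub>C v) = c *\<^sub>C blinfun_apply L v" for c v
  proof (rule LIMSEQ_unique[OF lim])
    have "blinfun_apply (blinfun_of_cblinfun (X n)) (c *\<^sub>C v)
        = c *\<^sub>C blinfun_apply (blinfun_of_cblinfun (X n)) v" for n
      using blinfun_of_cblinfun[of "X n"] by simp
    then show "(\<lambda>n. blinfun_apply (blinfun_of_cblinfun (X n)) (c *\<^sub>C v))
        \<longlonglongrightarrow> c *\<^sub>C blinfun_apply L v"
      using bounded_bilinear.tendsto[OF bounded_bilinear_scaleC tendsto_const lim] by simp
  qed
  then have "blinfun_of_cblinfun (CBlinfun L) = L"
    by (simp add: CBlinfun_inverse)
  then have "X \<longlonglongrightarrow> CBlinfun L"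
    using L unfolding LIMSEQ_def dist_norm
    by (simp add: norm_cblinfun.rep_eq minus_cblinfun.rep_eq)
  then show "convergent X"
    by (auto simp: convergent_def)
qed

end

lift_definition id_cblinfun :: "'a::complex_banach \<Rightarrow>\<^sub>\<complex> 'a" is id_blinfun
  by simp

lift_definition cblinfun_compose ::
  "('b::complex_banach \<Rightarrow>\<^sub>\<complex> 'c::complex_banach) \<Rightarrow> ('a::complex_banach \<Rightarrow>\<^sub>\<complex> 'b) \<Rightarrow> ('a \<Rightarrow>\<^sub>\<complex> 'c)"
    (infixl \<open>o\<^sub>C\<close> 55)
  is blinfun_compose
  by simp

lemma cblinfun_eqI: "(\<And>x. cblinfun_apply S x = cblinfun_apply T x) \<Longrightarrow> S = T"
  by transfer (rule blinfun_eqI)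

lemma cblinfun_apply_add: "cblinfun_apply T (x + y) = cblinfun_apply T x + cblinfun_apply T y"
  by transfer (rule blinfun.add_right)

lemma cblinfun_apply_scaleC: "cblinfun_apply T (c *\<^sub>C x) = c *\<^sub>C cblinfun_apply T x"
  by transfer simp

lemma norm_cblinfun_apply: "norm (cblinfun_apply T x) \<le> norm T * norm x"
  by transfer (rule norm_blinfun)

lemma cblinfun_apply_minus_scaleC_id:
  "cblinfun_apply (T - c *\<^sub>C id_cblinfun) x = cblinfun_apply T x - c *\<^sub>C x"
  by transfer
    (simp add: blinfun.diff_left bounded_linear_Blinfun_apply
      bounded_bilinear.bounded_linear_right[OF bounded_bilinear_scaleC])

lemma cblinfun_compose_apply: "cblinfun_apply (S o\<^sub>C T) x = cblinfun_apply S (cblinfun_apply T x)"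
  by transfer simp

type_synonym 'a cdual = "('a, complex) cblinfun"

text \<open>The Banach-space adjoint: a complex-linear (not conjugate-linear) function of the operator.\<close>

definition cdual_op ::
    "('a::complex_banach \<Rightarrow>\<^sub>\<complex> 'b::complex_banach) \<Rightarrow> ('b cdual \<Rightarrow>\<^sub>\<complex> 'a cdual)"
  where "cdual_op T = CBlinfun (Blinfun (\<lambda>\<phi>. \<phi> o\<^sub>C T))"

lemma cdual_op_apply: "cblinfun_apply (cdual_op T) \<phi> = \<phi> o\<^sub>C T"
proof -
  have scale: "(c *\<^sub>C \<phi>) o\<^sub>C T = c *\<^sub>C (\<phi> o\<^sub>C T)" for c and \<phi> :: "'b cdual"
    by transfer (rule blinfun_eqI, simp)
  have add: "(\<phi> + \<psi>) o\<^sub>C T = (\<phi> o\<^sub>C T) + (\<psi> o\<^sub>C T)" for \<phi> \<psi> :: "'b cdual"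
    by transfer (rule blinfun_eqI, simp add: blinfun.add_left)
  have norm: "norm (\<phi> o\<^sub>C T) \<le> norm \<phi> * norm T" for \<phi> :: "'b cdual"
    by transfer (rule norm_blinfun_compose)
  have bl: "bounded_linear (\<lambda>\<phi>::'b cdual. \<phi> o\<^sub>C T)"
    by (rule bounded_linear_intro[where K = "norm T"])
      (simp_all add: add norm scale flip: scaleC_of_real)
  have "blinfun_of_cblinfun (CBlinfun (Blinfun (\<lambda>\<phi>::'b cdual. \<phi> o\<^sub>C T))) = Blinfun (\<lambda>\<phi>. \<phi> o\<^sub>C T)"
    by (rule CBlinfun_inverse) (simp add: bounded_linear_Blinfun_apply[OF bl] scale)
  then show ?thesis
    by (simp add: cdual_op_def cblinfun_apply.rep_eq bounded_linear_Blinfun_apply[OF bl])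
qed


section \<open>Restrictions of operators to invariant subspaces\<close>

definition direct_sum :: "'a::complex_banach set \<Rightarrow> 'a set \<Rightarrow> 'a set \<Rightarrow> bool"
  where "direct_sum M N P \<longleftrightarrow> M \<inter> N = {0} \<and> {x + y | x y. x \<in> M \<and> y \<in> N} = P"

definition closed_csubspace :: "'a::complex_banach set \<Rightarrow> bool"
  where "closed_csubspace M \<longleftrightarrow> csubspace M \<and> closed M"

definition invariant_under :: "('a \<Rightarrow> 'a) \<Rightarrow> 'a set \<Rightarrow> bool"
  where "invariant_under S M \<longleftrightarrow> S ` M \<subseteq> M"

text \<open>A function on the whole space represents the operator on the subspace \<open>M\<close> that it restricts
  to; its values outside \<open>M\<close> are irrelevant to all the following notions.\<close>

definition bounded_op_on :: "'a::complex_banach set \<Rightarrow> ('a \<Rightarrow> 'a) \<Rightarrow> bool"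
  where "bounded_op_on M S \<longleftrightarrow> invariant_under S M
    \<and> (\<forall>x\<in>M. \<forall>y\<in>M. S (x + y) = S x + S y)
    \<and> (\<forall>c. \<forall>x\<in>M. S (c *\<^sub>C x) = c *\<^sub>C S x)
    \<and> (\<exists>K. \<forall>x\<in>M. norm (S x) \<le> K * norm x)"

definition invertible_on :: "'a::complex_banach set \<Rightarrow> ('a \<Rightarrow> 'a) \<Rightarrow> bool"
  where "invertible_on M S \<longleftrightarrow> (\<exists>R. bounded_op_on M R \<and> (\<forall>x\<in>M. R (S x) = x \<and> S (R x) = x))"

definition spectrum_on :: "'a::complex_banach set \<Rightarrow> ('a \<Rightarrow> 'a) \<Rightarrow> complex set"
  where "spectrum_on M S = {z. \<not> invertible_on M (\<lambda>x. S x - z *\<^sub>C x)}"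

text \<open>Inclusion rather than equality, since the spectrum is empty on the zero space.\<close>

definition quasinilpotent_on :: "'a::complex_banach set \<Rightarrow> ('a \<Rightarrow> 'a) \<Rightarrow> bool"
  where "quasinilpotent_on M S \<longleftrightarrow> spectrum_on M S \<subseteq> {0}"

definition cfinite_dim :: "'a::complex_banach set \<Rightarrow> bool"
  where "cfinite_dim M \<longleftrightarrow> (\<exists>B. finite B \<and> M \<subseteq> cspan B)"

definition kernel_on :: "'a::complex_banach set \<Rightarrow> ('a \<Rightarrow> 'a) \<Rightarrow> 'a set"
  where "kernel_on M S = {x \<in> M. S x = 0}"

text \<open>The quotient \<open>M / N\<close> is isomorphic to every algebraic complement of \<open>N\<close> in \<open>M\<close>; lemma
  \<open>codim_in_eq\<close> below shows that the choice of the complement does not matter.\<close>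

definition fin_complement_in :: "'a::complex_banach set \<Rightarrow> 'a set \<Rightarrow> 'a set \<Rightarrow> bool"
  where "fin_complement_in M N F \<longleftrightarrow> csubspace F \<and> cfinite_dim F \<and> direct_sum N F M"

definition finite_codim_in :: "'a::complex_banach set \<Rightarrow> 'a set \<Rightarrow> bool"
  where "finite_codim_in M N \<longleftrightarrow> (\<exists>F. fin_complement_in M N F)"

definition codim_in :: "'a::complex_banach set \<Rightarrow> 'a set \<Rightarrow> nat"
  where "codim_in M N = (THE n. \<exists>F. fin_complement_in M N F \<and> cdim F = n)"

text \<open>For bounded operators on Banach spaces, a range of finite codimension is closed.\<close>

definition fredholm_on :: "'a::complex_banach set \<Rightarrow> ('a \<Rightarrow> 'a) \<Rightarrow> bool"
  where "fredholm_on M S \<longleftrightarrow> cfinite_dim (kernel_on M S) \<and> finite_codim_in M (S ` M)"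

definition index_on :: "'a::complex_banach set \<Rightarrow> ('a \<Rightarrow> 'a) \<Rightarrow> int"
  where "index_on M S = int (cdim (kernel_on M S)) - int (codim_in M (S ` M))"

definition weyl_on :: "'a::complex_banach set \<Rightarrow> ('a \<Rightarrow> 'a) \<Rightarrow> bool"
  where "weyl_on M S \<longleftrightarrow> fredholm_on M S \<and> index_on M S = 0"

lemma fin_complement_cdim_le:
  assumes N: "csubspace N" and F: "fin_complement_in M N F" and G: "fin_complement_in M N G"
  shows "cdim F \<le> cdim G"
proof -
  note sub = complex_vector.subspace_diff complex_vector.subspace_add
    complex_vector.subspace_scale complex_vector.subspace_0
  have sF: "csubspace F" and iF: "N \<inter> F = {0}" and MF: "M = {x + y | x y. x \<in> N \<and> y \<in> F}"
    and sG: "csubspace G" and iG: "N \<inter> G = {0}" and MG: "M = {x + y | x y. x \<in> N \<and> y \<in> G}"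
    using F G by (auto simp: fin_complement_in_def direct_sum_def)
  obtain B where B: "B \<subseteq> F" "cindependent B" "F \<subseteq> cspan B" "card B = cdim F"
    using complex_vector.basis_exists[of F] by blast
  obtain W where W: "W \<subseteq> G" "cindependent W" "G \<subseteq> cspan W" "card W = cdim G"
    using complex_vector.basis_exists[of G] by blast
  have finW: "finite W"
    using G W(1,2) complex_vector.independent_span_bound
    unfolding fin_complement_in_def cfinite_dim_def by (meson order_trans)
  have ex: "\<exists>g\<in>G. y - g \<in> N" if "y \<in> F" for y
  proof -
    have "y \<in> M" unfolding MF using that sub(4)[OF N] by force
    then obtain n g where "n \<in> N" "g \<in> G" "y = n + g" unfolding MG by blast
    then show ?thesis by (intro bexI[of _ g]) auto
  qed
  interpret VP: vector_space_pair "scaleC :: complex \<Rightarrow> 'a \<Rightarrow> 'a" "scaleC :: complex \<Rightarrow> 'a \<Rightarrow> 'a"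
    by unfold_locales
  obtain p0 where p0: "\<And>y. y \<in> F \<Longrightarrow> p0 y \<in> G \<and> y - p0 y \<in> N"
    using ex by metis
  obtain p where p: "Vector_Spaces.linear scaleC scaleC p" "\<forall>x\<in>B. p x = p0 x"
    using VP.linear_independent_extend[of B p0] B(2) by (auto simp: cdependent_def)
  have pF: "p y \<in> G \<and> y - p y \<in> N" if "y \<in> cspan B" for y
    using that
  proof (induction rule: complex_vector.span_induct_alt)
    case base
    then show ?case using sub(4)[OF sG] sub(4)[OF N] VP.linear_0[OF p(1)] by simp
  next
    case (step c x y)
    have x: "p x \<in> G" "x - p x \<in> N" using p(2) step(1) p0 B(1) by auto
    have p_eq: "p (c *\<^sub>C x + y) = c *\<^sub>C p x + p y"
      by (simp add: VP.linear_add[OF p(1)] VP.linear_scale[OF p(1)])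
    have "c *\<^sub>C x + y - p (c *\<^sub>C x + y) = c *\<^sub>C (x - p x) + (y - p y)"
      by (simp add: p_eq complex_vector.scale_right_diff_distrib)
    moreover have "c *\<^sub>C (x - p x) + (y - p y) \<in> N"
      using x step by (intro sub(2)[OF N] sub(3)[OF N]) auto
    moreover have "c *\<^sub>C p x + p y \<in> G"
      using x step by (intro sub(2)[OF sG] sub(3)[OF sG]) auto
    ultimately show ?case by (metis p_eq)
  qed
  have BF: "cspan B = F"
    using B(1,3) sF complex_vector.span_minimal by blast
  have inj: "inj_on p (cspan B)"
  proof (rule inj_onI)
    fix x y assume xy: "x \<in> cspan B" "y \<in> cspan B" "p x = p y"
    then have "(x - p x) - (y - p y) \<in> N" using pF sub(1)[OF N] by blast
    then have "x - y \<in> N \<inter> F" using xy sub(1)[OF sF] BF by auto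
    then show "x = y" using iF by simp
  qed
  have ind: "cindependent (p ` B)"
    using VP.linear_independent_injective_image[OF p(1)] B(2) inj by (auto simp: cdependent_def cspan_def)
  have "p ` B \<subseteq> cspan W"
    using pF W(3) complex_vector.span_base by blast
  from complex_vector.independent_span_bound[OF finW ind this]
  have "card (p ` B) \<le> card W" by blast
  moreover have "card (p ` B) = card B"
    using inj complex_vector.span_superset by (intro card_image) (rule inj_on_subset)
  ultimately show ?thesis using B W by simp
qed

lemma codim_in_eq:
  assumes "csubspace N" and "fin_complement_in M N F"
  shows "codim_in M N = cdim F"
  unfolding codim_in_def
proof (rule the_equality)
  show "\<exists>G. fin_complement_in M N G \<and> cdim G = cdim F"
    using assms by blast
  show "n = cdim F" if "\<exists>G. fin_complement_in M N G \<and> cdim G = n" for n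
    using that assms fin_complement_cdim_le by (metis order_antisym)
qed


section \<open>Generalized Drazin invertible and pseudo B-Weyl operators\<close>

definition generalized_Drazin_invertible :: "('a::complex_banach \<Rightarrow>\<^sub>\<complex> 'a) \<Rightarrow> bool"
  where "generalized_Drazin_invertible T \<longleftrightarrow>
    (\<exists>M N. closed_csubspace M \<and> closed_csubspace N \<and> invariant_under T M \<and> invariant_under T N
      \<and> direct_sum M N UNIV \<and> invertible_on M T \<and> quasinilpotent_on N T)"

definition pseudo_B_Weyl :: "('a::complex_banach \<Rightarrow>\<^sub>\<complex> 'a) \<Rightarrow> bool"
  where "pseudo_B_Weyl T \<longleftrightarrow>
    (\<exists>M N. closed_csubspace M \<and> closed_csubspace N \<and> invariant_under T M \<and> invariant_under T N
      \<and> direct_sum M N UNIV \<and> weyl_on M T \<and> quasinilpotent_on N T)"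

definition sigma_gD :: "('a::complex_banach \<Rightarrow>\<^sub>\<complex> 'a) \<Rightarrow> complex set"
  where "sigma_gD T = {z. \<not> generalized_Drazin_invertible (T - z *\<^sub>C id_cblinfun)}"

definition sigma_gDW :: "('a::complex_banach \<Rightarrow>\<^sub>\<complex> 'a) \<Rightarrow> complex set"
  where "sigma_gDW T = {z. \<not> pseudo_B_Weyl (T - z *\<^sub>C id_cblinfun)}"


section \<open>The single valued extension property\<close>

text \<open>The library's \<open>analytic_on\<close> is restricted to complex-valued functions. On an open set, the
  following local power series condition is equivalent to complex differentiability.\<close>

definition vector_analytic_on :: "(complex \<Rightarrow> 'a::complex_banach) \<Rightarrow> complex set \<Rightarrow> bool"
  where "vector_analytic_on f U \<longleftrightarrow>
    (\<forall>z\<in>U. \<exists>r>0. \<exists>a. \<forall>w\<in>ball z r. (\<lambda>n. (w - z) ^ n *\<^sub>C a n) sums f w)"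

definition SVEP_at :: "('a::complex_banach \<Rightarrow>\<^sub>\<complex> 'a) \<Rightarrow> complex \<Rightarrow> bool"
  where "SVEP_at S z0 \<longleftrightarrow>
    (\<forall>U f. open U \<and> connected U \<and> z0 \<in> U \<and> vector_analytic_on f U
        \<and> (\<forall>z\<in>U. cblinfun_apply (S - z *\<^sub>C id_cblinfun) (f z) = 0)
      \<longrightarrow> (\<forall>z\<in>U. f z = 0))"

end

theory Submission
  imports Defs
begin

text \<open>
  Write \<open>S = T - z I\<close>. The inclusion \<open>sigma_gDW T \<subseteq> sigma_gD T\<close> always holds, since an
  invertible operator is a Weyl operator. So the equality of the two sets says that \<open>S\<close> is
  generalized Drazin invertible as soon as it is pseudo B-Weyl, and the theorem follows from two
  implications for a fixed \<open>z\<close>.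

  \<^bold>\<open>Generalized Drazin invertibility gives the SVEP\<close> (lemma \<open>SVEP_at_if_generalized_Drazin\<close>). Let
  \<open>X = M \<oplus> N\<close> with \<open>S\<close> invertible on \<open>M\<close> and quasi-nilpotent on \<open>N\<close>. For small \<open>w \<noteq> 0\<close> the operator
  \<open>S - w I\<close> is injective on both summands, and a functional that vanishes on its range vanishes on
  both summands. So neither \<open>T\<close> nor its adjoint has an eigenvalue in a punctured disc about \<open>z\<close>,
  an analytic solution \<open>f\<close> of the eigenvalue equation is zero there, and the identity theorem makes
  it zero on the whole connected domain.

  \<^bold>\<open>Pseudo B-Weyl with the SVEP gives generalized Drazin invertibility\<close> (lemma
  \<open>generalized_Drazin_if_pseudo_B_Weyl_and_SVEP\<close>). Let \<open>X = M \<oplus> N\<close> with \<open>S\<close> Weyl on \<open>M\<close> and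
  quasi-nilpotent on \<open>N\<close>.

  The SVEP forces \<open>S\<close> to have finite ascent on \<open>M\<close>. Otherwise \<open>ker S\<close> meets every range \<open>S\<^sup>n M\<close>
  nontrivially. As \<open>ker S\<close> is finite-dimensional, the intersections stabilise, so there is
  \<open>x\<^sub>0 \<noteq> 0\<close> in \<open>ker S\<close> and in all ranges. These ranges have finite codimension and are therefore
  closed, \<open>S\<close> maps their intersection onto itself, and the open mapping theorem yields a chain
  \<open>S x\<^sub>n\<^sub>+\<^sub>1 = x\<^sub>n\<close> of at most geometric growth (\<open>bounded_chain_of_infinite_ascent\<close>). The series
  \<open>f w = \<Sum>n. (w - z)\<^sup>n x\<^sub>n\<close> is then an analytic family of eigenvectors with \<open>f z = x\<^sub>0 \<noteq> 0\<close>,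
  contradicting the SVEP.

  Index zero turns finite ascent \<open>p\<close> into a splitting \<open>M = S\<^sup>p M \<oplus> ker S\<^sup>p\<close> with \<open>S\<close> bijective on
  \<open>S\<^sup>p M\<close>, by a dimension count (\<open>weyl_with_finite_ascent\<close>). On \<open>ker S\<^sup>p\<close> the operator is
  nilpotent, so it is quasi-nilpotent on the closed subspace \<open>ker S\<^sup>p \<oplus> N\<close>, and
  \<open>X = S\<^sup>p M \<oplus> (ker S\<^sup>p \<oplus> N)\<close> is the required decomposition.
\<close>

section \<open>The open mapping theorem between closed subspaces\<close>

text \<open>
  The Baire half of the open mapping theorem: the closure of the image of some ball of \<open>M\<close>
  has interior in \<open>R\<close>, and differences of two points of that image approximate every small vector
  of \<open>R\<close>. The target need only be hit up to half its norm, so that the error can be fed back in.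
\<close>

lemma approximate_preimages_on_closed_subspace:
  fixes f :: "'a::banach \<Rightarrow> 'b::banach"
  assumes f: "bounded_linear f" and M: "subspace M" and R: "closed R" and img: "f ` M = R"
  obtains C where "C > 0"
    and "\<And>y. y \<in> R \<Longrightarrow> \<exists>x\<in>M. norm x \<le> C * norm y \<and> norm (y - f x) \<le> norm y / 2"
proof -
  interpret f: bounded_linear f by (rule f)
  define E where "E n = closure (f ` (M \<inter> cball 0 (real n)))" for n :: nat
  have 0: "0 \<in> M" by (rule subspace_0[OF M])
  have sR: "subspace R" using linear_subspace_image[OF f.linear_axioms M] img by simp
  have E_sub: "E n \<subseteq> R" for n
    unfolding E_def by (rule closure_minimal[OF _ R]) (use img in auto)
  have "(\<Union>n. E n) = R"
  proof
    show "R \<subseteq> (\<Union>n. E n)"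
    proof
      fix y assume "y \<in> R"
      then obtain x where x: "x \<in> M" "y = f x" using img by auto
      obtain n where "norm x \<le> real n" using real_arch_simple by blast
      then have "y \<in> E n" unfolding E_def using x by (intro subsetD[OF closure_subset]) auto
      then show "y \<in> (\<Union>n. E n)" by blast
    qed
  qed (use E_sub in blast)
  moreover have "top_of_set R interior_of R \<noteq> {}"
    using interior_of_topspace[of "top_of_set R"] subspace_0[OF sR] by auto
  ultimately have "\<exists>n. top_of_set R interior_of E n \<noteq> {}"
    using Baire_category_alt[of "top_of_set R" "range E"]
      completely_metrizable_space_closedin[OF completely_metrizable_space_euclidean, of R]
      closed_closedin[of R] R E_sub by (fastforce simp: E_def intro: closed_subset)
  then obtain n y0 where "y0 \<in> top_of_set R interior_of E n" by blast
  then obtain U where U: "openin (top_of_set R) U" "y0 \<in> U" "U \<subseteq> E n"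
    by (auto simp: interior_of_def)
  then obtain e where e: "e > 0" "ball y0 e \<inter> R \<subseteq> E n"
    by (meson openin_contains_ball order_trans)
  have y0: "y0 \<in> R" using U E_sub by blast
  have near: "\<exists>x\<in>M. norm x \<le> real n \<and> norm (v - f x) < e / 8" if "v \<in> R" "dist y0 v < e" for v
  proof -
    have "v \<in> closure (f ` (M \<inter> cball 0 (real n)))" using e that unfolding E_def by auto
    then obtain w where "w \<in> f ` (M \<inter> cball 0 (real n))" "dist w v < e / 8"
      unfolding closure_approachable using e(1) by (metis divide_pos_pos zero_less_numeral)
    then show ?thesis by (auto simp: dist_norm norm_minus_commute)
  qed
  show thesis
  proof
    show "4 * real n / e + 1 > 0" using e by (intro add_nonneg_pos) auto
    fix y assume y: "y \<in> R"
    show "\<exists>x\<in>M. norm x \<le> (4 * real n / e + 1) * norm y \<and> norm (y - f x) \<le> norm y / 2"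
    proof (cases "y = 0")
      case True then show ?thesis using 0 by (intro bexI[of _ 0]) (auto simp: f.zero)
    next
      case False
      \<comment> \<open>\<open>y0 + t y\<close> stays inside the ball of radius \<open>e\<close> in which all points of \<open>R\<close> are approximable;
        dividing the difference of two approximations by \<open>t\<close> recovers \<open>y\<close>.\<close>
      define t where "t = e / (2 * norm y)"
      have t: "t > 0" and ty: "t * norm y = e / 2" using e False by (auto simp: t_def)
      have "y0 + t *\<^sub>R y \<in> R" using y y0 sR by (simp add: subspace_add subspace_scale)
      moreover have "dist y0 (y0 + t *\<^sub>R y) < e" using t ty e by (simp add: dist_norm)
      ultimately obtain x1 where x1: "x1 \<in> M" "norm x1 \<le> real n" "norm (y0 + t *\<^sub>R y - f x1) < e / 8"
        using near by blast
      obtain x2 where x2: "x2 \<in> M" "norm x2 \<le> real n" "norm (y0 - f x2) < e / 8"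
        using near[OF y0] e by auto
      define x where "x = (1 / t) *\<^sub>R (x1 - x2)"
      have "norm (x1 - x2) \<le> 2 * real n" using x1(2) x2(2) norm_triangle_ineq4[of x1 x2] by simp
      then have "norm x \<le> (1 / t) * (2 * real n)" unfolding x_def using t by (simp add: divide_right_mono)
      also have "\<dots> = 4 * real n / e * norm y" using e by (simp add: t_def)
      also have "\<dots> \<le> (4 * real n / e + 1) * norm y" by (simp add: algebra_simps)
      finally have nx: "norm x \<le> (4 * real n / e + 1) * norm y" .
      have "t *\<^sub>R (y - f x) = (y0 + t *\<^sub>R y - f x1) - (y0 - f x2)"
        using t by (simp add: x_def f.scaleR f.diff algebra_simps)
      then have "t * norm (y - f x) = norm ((y0 + t *\<^sub>R y - f x1) - (y0 - f x2))"
        using t by (metis abs_of_pos norm_scaleR)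
      also have "\<dots> \<le> norm (y0 + t *\<^sub>R y - f x1) + norm (y0 - f x2)" by (rule norm_triangle_ineq4)
      also have "\<dots> \<le> t * (norm y / 2)" using x1(3) x2(3) ty by simp
      finally have "norm (y - f x) \<le> norm y / 2" using t by simp
      moreover have "x \<in> M" unfolding x_def using x1 x2 M by (simp add: subspace_diff subspace_scale)
      ultimately show ?thesis using nx by blast
    qed
  qed
qed

text \<open>
  Bounded preimages are obtained by correcting the error of an approximate preimage again and
  again; the corrections shrink geometrically. The theorem is stated for a map between closed
  subspaces of the ambient spaces because it is applied to operators restricted to such
  subspaces, and, on products, to the sum map of a direct decomposition.
\<close>

theorem open_mapping_on_closed_subspace:
  fixes f :: "'a::banach \<Rightarrow> 'b::banach"
  assumes f: "bounded_linear f" and M: "subspace M" "closed M" and R: "closed R" and img: "f ` M = R"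
  obtains C where "C > 0" and "\<And>y. y \<in> R \<Longrightarrow> \<exists>x\<in>M. f x = y \<and> norm x \<le> C * norm y"
proof -
  interpret f: bounded_linear f by (rule f)
  have sR: "subspace R" using linear_subspace_image[OF f.linear_axioms M(1)] img by simp
  obtain C where C: "C > 0"
    "\<And>y. y \<in> R \<Longrightarrow> \<exists>x\<in>M. norm x \<le> C * norm y \<and> norm (y - f x) \<le> norm y / 2"
    using approximate_preimages_on_closed_subspace[OF f M(1) R img] by blast
  then obtain g where g: "\<And>y. y \<in> R \<Longrightarrow> g y \<in> M" "\<And>y. y \<in> R \<Longrightarrow> norm (g y) \<le> C * norm y"
    "\<And>y. y \<in> R \<Longrightarrow> norm (y - f (g y)) \<le> norm y / 2"
    by metis
  show thesis
  proof
    show "2 * C > 0" using C by simp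
    fix y assume y: "y \<in> R"
    \<comment> \<open>the error that is left after \<open>k\<close> corrections\<close>
    define r where "r k = ((\<lambda>v. v - f (g v)) ^^ k) y" for k
    have r_Suc: "r (Suc k) = r k - f (g (r k))" for k by (simp add: r_def)
    have rR: "r k \<in> R" for k
    proof (induction k)
      case 0 then show ?case using y by (simp add: r_def)
    next
      case (Suc k)
      then show ?case unfolding r_Suc using g(1) img by (intro subspace_diff[OF sR]) auto
    qed
    have r_le: "norm (r k) \<le> (1/2) ^ k * norm y" for k
    proof (induction k)
      case 0 then show ?case by (simp add: r_def)
    next
      case (Suc k) then show ?case using g(3)[OF rR[of k]] by (simp add: r_Suc)
    qed
    have gr_le: "norm (g (r k)) \<le> (1/2) ^ k * (C * norm y)" for k
    proof -
      have "norm (g (r k)) \<le> C * norm (r k)" by (rule g(2)[OF rR])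
      also have "\<dots> \<le> C * ((1/2) ^ k * norm y)" using C(1) r_le by (intro mult_left_mono) auto
      finally show ?thesis by (simp add: mult_ac)
    qed
    have geo: "(\<lambda>k. (1/2) ^ k * (C * norm y)) sums (2 * (C * norm y))"
      using sums_mult2[OF geometric_sums[of "1/2 :: real"], of "C * norm y"] by simp
    have sg: "summable (\<lambda>k. norm (g (r k)))"
      by (rule summable_comparison_test[OF _ sums_summable[OF geo]]) (use gr_le in auto)
    then have sums: "(\<lambda>k. g (r k)) sums (\<Sum>k. g (r k))" by (rule summable_sums[OF summable_norm_cancel])
    define x where "x = (\<Sum>k. g (r k))"
    have "norm x \<le> 2 * C * norm y"
    proof -
      have "norm x \<le> (\<Sum>k. norm (g (r k)))" unfolding x_def by (rule summable_norm[OF sg])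
      also have "\<dots> \<le> (\<Sum>k. (1/2) ^ k * (C * norm y))"
        by (rule suminf_le[OF gr_le sg sums_summable[OF geo]])
      also have "\<dots> = 2 * C * norm y" using sums_unique[OF geo] by simp
      finally show ?thesis .
    qed
    moreover have "x \<in> M"
    proof (rule closed_sequentially[OF M(2)])
      show "(\<lambda>n. \<Sum>k<n. g (r k)) \<longlonglongrightarrow> x" using sums by (simp add: sums_def x_def)
      show "(\<Sum>k<n. g (r k)) \<in> M" for n using g(1) rR by (intro subspace_sum[OF M(1)]) auto
    qed
    moreover have "f x = y"
    proof (rule sums_unique2)
      show "(\<lambda>k. f (g (r k))) sums f x" unfolding x_def by (rule f.sums[OF sums])
      have "(\<lambda>k. (1/2) ^ k * norm y) \<longlonglongrightarrow> 0"
        by (intro tendsto_mult_left_zero LIMSEQ_realpow_zero) auto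
      then have "r \<longlonglongrightarrow> 0" by (rule Lim_null_comparison[rotated]) (simp add: r_le)
      then have "(\<lambda>k. r k - r (Suc k)) sums (r 0 - 0)" by (rule telescope_sums')
      then show "(\<lambda>k. f (g (r k))) sums y" by (simp add: r_Suc r_def)
    qed
    ultimately show "\<exists>x\<in>M. f x = y \<and> norm x \<le> 2 * C * norm y" by blast
  qed
qed

section \<open>Vector-valued power series\<close>

text \<open>
  Zeros of a nonzero power series are isolated: if \<open>a n\<close> is the first nonzero coefficient, then at
  distance \<open>s\<close> from the centre the term of order \<open>n\<close> has size \<open>s ^ n * norm (a n)\<close>, while the
  remaining terms sum to \<open>O(s ^ (n + 1))\<close>, so they cannot cancel it for small \<open>s\<close>.
\<close>

lemma vector_powser_frequently_zero_imp_zero: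
  fixes a :: "nat \<Rightarrow> 'a::complex_banach"
  assumes r: "r > 0" and f: "\<And>w. w \<in> ball z r \<Longrightarrow> (\<lambda>n. (w - z) ^ n *\<^sub>C a n) sums f w"
    and zeros: "\<And>e. e > 0 \<Longrightarrow> \<exists>w. w \<noteq> z \<and> dist z w < e \<and> f w = 0"
  shows "a n = 0"
proof (induction n rule: less_induct)
  case (less n)
  define \<rho> where "\<rho> = r / 2"
  have \<rho>: "\<rho> > 0" using r by (simp add: \<rho>_def)
  have "(\<lambda>k. complex_of_real \<rho> ^ k *\<^sub>C a k) sums f (z + complex_of_real \<rho>)"
    using f[of "z + complex_of_real \<rho>"] \<rho> by (simp add: dist_norm \<rho>_def)
  then have "Bseq (\<lambda>k. complex_of_real \<rho> ^ k *\<^sub>C a k)"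
    using summable_LIMSEQ_zero sums_summable convergent_imp_Bseq convergentI by metis
  then obtain D where D: "D > 0" "\<And>k. norm (complex_of_real \<rho> ^ k *\<^sub>C a k) \<le> D"
    by (auto elim!: BseqE)
  have a_le: "norm (a k) \<le> D / \<rho> ^ k" for k
    using D(2)[of k] \<rho> by (simp add: norm_scaleC norm_power field_simps)
  have small: "norm (a n) \<le> 2 * D / \<rho> ^ Suc n * cmod (w - z)"
    if w: "w \<noteq> z" "dist z w \<le> \<rho> / 2" "f w = 0" for w
  proof -
    define s where "s = cmod (w - z)"
    have s: "s > 0" "s \<le> \<rho> / 2" using w by (auto simp: s_def dist_norm norm_minus_commute)
    have "w \<in> ball z r" using w(2) r by (auto simp: \<rho>_def)
    from f[OF this] have "(\<lambda>k. (w - z) ^ k *\<^sub>C a k) sums 0" by (simp add: w(3))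
    from sums_split_initial_segment[OF this, of "Suc n"]
    have "(\<lambda>k. (w - z) ^ (k + Suc n) *\<^sub>C a (k + Suc n)) sums (0 - (\<Sum>k<Suc n. (w - z) ^ k *\<^sub>C a k))" .
    moreover have "(\<Sum>k<Suc n. (w - z) ^ k *\<^sub>C a k) = (w - z) ^ n *\<^sub>C a n"
      using less by simp
    ultimately have tail: "(\<lambda>k. (w - z) ^ (k + Suc n) *\<^sub>C a (k + Suc n)) sums (- ((w - z) ^ n *\<^sub>C a n))"
      by simp
    have le: "norm ((w - z) ^ (k + Suc n) *\<^sub>C a (k + Suc n)) \<le> (1/2) ^ k * (D * (s / \<rho>) ^ Suc n)" for k
    proof -
      have "norm ((w - z) ^ (k + Suc n) *\<^sub>C a (k + Suc n)) \<le> s ^ (k + Suc n) * (D / \<rho> ^ (k + Suc n))"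
        unfolding norm_scaleC norm_power s_def[symmetric] using s a_le[of "k + Suc n"] by (intro mult_left_mono) auto
      also have "\<dots> = (s / \<rho>) ^ k * (D * (s / \<rho>) ^ Suc n)"
        by (simp add: power_add power_divide mult_ac)
      also have "\<dots> \<le> (1/2) ^ k * (D * (s / \<rho>) ^ Suc n)"
        using s \<rho> D(1) by (intro mult_right_mono power_mono) (auto simp: field_simps)
      finally show ?thesis .
    qed
    have geo: "(\<lambda>k. (1/2) ^ k * (D * (s / \<rho>) ^ Suc n)) sums (2 * (D * (s / \<rho>) ^ Suc n))"
      using sums_mult2[OF geometric_sums[of "1/2 :: real"], of "D * (s / \<rho>) ^ Suc n"] by simp
    have sn: "summable (\<lambda>k. norm ((w - z) ^ (k + Suc n) *\<^sub>C a (k + Suc n)))"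
      by (rule summable_comparison_test[OF _ sums_summable[OF geo]]) (use le in auto)
    have "s ^ n * norm (a n) = norm (\<Sum>k. (w - z) ^ (k + Suc n) *\<^sub>C a (k + Suc n))"
      unfolding sums_unique[OF tail, symmetric] by (simp add: norm_scaleC norm_power s_def)
    also have "\<dots> \<le> (\<Sum>k. norm ((w - z) ^ (k + Suc n) *\<^sub>C a (k + Suc n)))" by (rule summable_norm[OF sn])
    also have "\<dots> \<le> (\<Sum>k. (1/2) ^ k * (D * (s / \<rho>) ^ Suc n))"
      by (rule suminf_le[OF le sn sums_summable[OF geo]])
    also have "\<dots> = s ^ n * (2 * D / \<rho> ^ Suc n * s)"
      unfolding sums_unique[OF geo, symmetric] by (simp add: power_divide)
    finally show ?thesis
      unfolding s_def[symmetric] by (rule mult_left_le_imp_le) (use s(1) in simp)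
  qed
  show "a n = 0"
  proof (rule ccontr)
    assume "a n \<noteq> 0"
    define c where "c = 2 * D / \<rho> ^ Suc n"
    have c: "c > 0" using D(1) \<rho> by (simp add: c_def)
    define e where "e = min (\<rho> / 2) (norm (a n) / c)"
    have "e > 0" using \<rho> c \<open>a n \<noteq> 0\<close> by (simp add: e_def)
    then obtain w where w: "w \<noteq> z" "dist z w < e" "f w = 0" using zeros by blast
    then have "norm (a n) \<le> c * cmod (w - z)" unfolding c_def by (intro small) (auto simp: e_def)
    also have "\<dots> < c * (norm (a n) / c)"
      using w(2) c by (intro mult_strict_left_mono) (auto simp: e_def dist_norm norm_minus_commute)
    finally show False using c by simp
  qed
qed

text \<open>
  The set \<open>E\<close> of points near which \<open>f\<close> vanishes is open by definition, and closed in \<open>U\<close> because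
  a limit point of \<open>E\<close> is a limit of zeros of \<open>f\<close>, where the power series has to be trivial.
\<close>

theorem vector_analytic_identity:
  assumes f: "vector_analytic_on f U" and U: "open U" "connected U" and z0: "z0 \<in> U"
    and ev: "\<forall>\<^sub>F w in at z0. f w = 0" and z: "z \<in> U"
  shows "f z = 0"
proof -
  define E where "E = {z. \<exists>e>0. \<forall>w\<in>ball z e. f w = 0}"
  have accum: "w \<in> E" if w: "w \<in> U" and zeros: "\<And>e. e > 0 \<Longrightarrow> \<exists>v. v \<noteq> w \<and> dist w v < e \<and> f v = 0" for w
  proof -
    obtain r a where r: "r > 0" "\<And>v. v \<in> ball w r \<Longrightarrow> (\<lambda>n. (v - w) ^ n *\<^sub>C a n) sums f v"
      using f w unfolding vector_analytic_on_def by blast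
    have "a n = 0" for n
      by (rule vector_powser_frequently_zero_imp_zero[OF r zeros])
    then have "f v = 0" if "v \<in> ball w r" for v
      using r(2)[OF that] sums_unique2[OF _ sums_zero] by simp
    then show ?thesis unfolding E_def using r(1) by blast
  qed
  have "open E"
  proof (rule openI)
    fix x assume "x \<in> E"
    then obtain e where e: "e > 0" "\<And>w. w \<in> ball x e \<Longrightarrow> f w = 0" unfolding E_def by blast
    have "ball x e \<subseteq> E"
      unfolding E_def using e(2) open_contains_ball[of "ball x e"] by blast
    then show "\<exists>e>0. ball x e \<subseteq> E" using e(1) by blast
  qed
  moreover have "z0 \<in> E"
  proof (rule accum[OF z0])
    fix e :: real assume "e > 0"
    obtain d where d: "d > 0" "\<And>w. w \<noteq> z0 \<Longrightarrow> dist w z0 < d \<Longrightarrow> f w = 0"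
      using ev unfolding eventually_at by auto
    show "\<exists>v. v \<noteq> z0 \<and> dist z0 v < e \<and> f v = 0"
      using \<open>e > 0\<close> d by (intro exI[of _ "z0 + complex_of_real (min d e / 2)"]) (auto simp: dist_norm)
  qed
  moreover have "openin (top_of_set U) (U \<inter> E)" using \<open>open E\<close> by auto
  moreover have "closedin (top_of_set U) (U \<inter> E)"
  proof -
    have "closure E \<inter> U \<subseteq> E"
    proof
      fix w assume w: "w \<in> closure E \<inter> U"
      show "w \<in> E"
      proof (rule accum)
        fix e :: real assume e: "e > 0"
        obtain v where v: "v \<in> E" "dist v w < e / 2"
          using w e closure_approachable[of w E] by (auto dest: spec[of _ "e / 2"])
        obtain d where d: "d > 0" "\<And>u. u \<in> ball v d \<Longrightarrow> f u = 0" using v(1) unfolding E_def by blast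
        show "\<exists>u. u \<noteq> w \<and> dist w u < e \<and> f u = 0"
        proof (cases "v = w")
          case True
          then show ?thesis using d e
            by (intro exI[of _ "w + complex_of_real (min d e / 2)"]) (auto simp: dist_norm)
        next
          case False
          then show ?thesis using d v e by (intro exI[of _ v]) (auto simp: dist_commute)
        qed
      qed (use w in blast)
    qed
    then have "U \<inter> E = U \<inter> closure E" using closure_subset by blast
    then show ?thesis by (metis closed_closure closedin_closed_Int)
  qed
  ultimately have "U \<inter> E = {} \<or> U \<inter> E = U" using U(2) unfolding connected_clopen by blast
  then have "z \<in> E" using z z0 \<open>z0 \<in> E\<close> by blast
  then show ?thesis unfolding E_def using centre_in_ball by blast
qed

text \<open>
  A power series can be expanded about every point \<open>w0\<close> of its disc of convergence: the binomial
  formula for \<open>(h + k) ^ n\<close> with \<open>h = w0 - z\<close>, \<open>k = w - w0\<close> gives an absolutely summable double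
  series, and summing it over \<open>n\<close> first produces the coefficients at \<open>w0\<close>.
\<close>

theorem vector_powser_analytic_on_ball:
  fixes x :: "nat \<Rightarrow> 'a::complex_banach"
  assumes C: "C > 0" and x: "\<And>n. norm (x n) \<le> D * C ^ n"
  shows "vector_analytic_on (\<lambda>w. \<Sum>n. (w - z) ^ n *\<^sub>C x n) (ball z (1 / C))"
  unfolding vector_analytic_on_def
proof
  fix w0 assume w0: "w0 \<in> ball z (1 / C)"
  define h where "h = w0 - z"
  define r where "r = 1 / C - cmod h"
  have r: "r > 0" using w0 by (simp add: r_def h_def dist_norm norm_minus_commute)
  define a where "a j = (\<Sum>\<^sub>\<infinity>n. (of_nat (n choose j) * h ^ (n - j)) *\<^sub>C x n)" for j
  have "(\<lambda>j. (w - w0) ^ j *\<^sub>C a j) sums (\<Sum>n. (w - z) ^ n *\<^sub>C x n)" if w: "w \<in> ball w0 r" for w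
  proof -
    define k where "k = w - w0"
    define q where "q = (cmod h + cmod k) * C"
    have "cmod h + cmod k < 1 / C" using w by (simp add: k_def r_def dist_norm norm_minus_commute)
    then have q: "0 \<le> q" "q < 1" using C by (auto simp: q_def field_simps)
    define F where "F = (\<lambda>(n, j). (of_nat (n choose j) * h ^ (n - j) * k ^ j) *\<^sub>C x n)"
    \<comment> \<open>Summing a row of the double series gives a term of the original series,
      summing a column gives a term of the series at \<open>w0\<close>.\<close>
    have row: "((\<lambda>j. F (n, j)) has_sum (w - z) ^ n *\<^sub>C x n) UNIV" for n
    proof -
      have "((\<lambda>j. F (n, j)) has_sum (\<Sum>j\<le>n. F (n, j))) {..n}" by (rule has_sum_finite) simp
      then have "((\<lambda>j. F (n, j)) has_sum (\<Sum>j\<le>n. F (n, j))) UNIV"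
        by (rule has_sum_cong_neutral[THEN iffD1, rotated -1]) (auto simp: F_def)
      moreover have "(\<Sum>j\<le>n. F (n, j)) = (w - z) ^ n *\<^sub>C x n"
        using binomial_ring[of k h n]
        by (simp add: F_def h_def k_def complex_vector.scale_sum_left[symmetric] mult_ac)
      ultimately show ?thesis by simp
    qed
    have nrow: "((\<lambda>j. norm (F (n, j))) has_sum (cmod h + cmod k) ^ n * norm (x n)) UNIV" for n
    proof -
      have "((\<lambda>j. norm (F (n, j))) has_sum (\<Sum>j\<le>n. norm (F (n, j)))) {..n}" by (rule has_sum_finite) simp
      then have "((\<lambda>j. norm (F (n, j))) has_sum (\<Sum>j\<le>n. norm (F (n, j)))) UNIV"
        by (rule has_sum_cong_neutral[THEN iffD1, rotated -1]) (auto simp: F_def)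
      moreover have "(\<Sum>j\<le>n. norm (F (n, j))) = (cmod h + cmod k) ^ n * norm (x n)"
        using binomial_ring[of "cmod k" "cmod h" n]
        by (simp add: F_def norm_scaleC norm_mult norm_power sum_distrib_left mult_ac add.commute)
      ultimately show ?thesis by simp
    qed
    have "summable (\<lambda>n. norm ((cmod h + cmod k) ^ n * norm (x n)))"
    proof (rule summable_comparison_test')
      show "summable (\<lambda>n. D * q ^ n)" using q by (intro summable_mult summable_geometric) auto
      show "norm (norm ((cmod h + cmod k) ^ n * norm (x n))) \<le> D * q ^ n" for n
        using mult_left_mono[OF x[of n], of "(cmod h + cmod k) ^ n"]
        by (simp add: q_def power_mult_distrib mult_ac abs_mult)
    qed
    then have "(\<lambda>n. norm ((cmod h + cmod k) ^ n * norm (x n))) summable_on UNIV"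
      by (intro norm_summable_imp_summable_on) simp
    then have sF: "(\<lambda>p. norm (F p)) summable_on UNIV \<times> UNIV"
      using has_sum_imp_summable[OF nrow]
      by (intro Infinite_Sum.abs_summable_on_Sigma_iff[THEN iffD2] conjI ballI) (simp_all only: infsumI[OF nrow])
    then obtain S where S: "(F has_sum S) (UNIV \<times> UNIV)"
      using Infinite_Sum.abs_summable_summable summable_on_def by blast
    have "((\<lambda>n. (w - z) ^ n *\<^sub>C x n) has_sum S) UNIV"
      by (rule has_sum_SigmaD[OF S row])
    then have S_eq: "S = (\<Sum>n. (w - z) ^ n *\<^sub>C x n)" by (meson has_sum_imp_sums sums_unique)
    have swapped: "((\<lambda>(j, n). F (n, j)) has_sum S) (UNIV \<times> UNIV)" using S by (rule has_sum_swap[THEN iffD1])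
    have col: "((\<lambda>n. F (n, j)) has_sum k ^ j *\<^sub>C a j) UNIV" for j
    proof -
      have "(\<lambda>p. norm (case p of (j, n) \<Rightarrow> F (n, j))) summable_on UNIV \<times> UNIV"
        using sF has_sum_swap[of "\<lambda>p. norm (F p)" UNIV UNIV]
        unfolding summable_on_def by (auto simp: case_prod_unfold)
      then have "(\<lambda>n. F (n, j)) summable_on UNIV"
        unfolding Infinite_Sum.abs_summable_on_Sigma_iff using Infinite_Sum.abs_summable_summable by fastforce
      then have sc: "((\<lambda>n. F (n, j)) has_sum (\<Sum>\<^sub>\<infinity>n. F (n, j))) UNIV" by simp
      have eq: "F (n, j) = k ^ j *\<^sub>C ((of_nat (n choose j) * h ^ (n - j)) *\<^sub>C x n)" for n
        by (simp add: F_def scaleC_scaleC mult_ac)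
      note bl = bounded_bilinear.bounded_linear_right[OF bounded_bilinear_scaleC]
      \<comment> \<open>\<open>k = 0\<close> at the new centre, where the factor \<open>k ^ j\<close> cannot be divided out of the sum.\<close>
      show ?thesis
      proof (cases "k ^ j = 0")
        case True
        show ?thesis unfolding eq True by simp
      next
        case False
        have cancel: "inverse (k ^ j) *\<^sub>C (k ^ j *\<^sub>C y) = y" for y :: 'a
          using False by (simp add: scaleC_scaleC scaleC_one)
        have "((\<lambda>n. inverse (k ^ j) *\<^sub>C F (n, j)) has_sum inverse (k ^ j) *\<^sub>C (\<Sum>\<^sub>\<infinity>n. F (n, j))) UNIV"
          by (rule has_sum_bounded_linear[OF bl sc])
        then have "a j = inverse (k ^ j) *\<^sub>C (\<Sum>\<^sub>\<infinity>n. F (n, j))"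
          unfolding a_def by (intro infsumI) (simp only: eq cancel)
        then show ?thesis using sc False by (simp add: scaleC_scaleC scaleC_one)
      qed
    qed
    have "((\<lambda>j. k ^ j *\<^sub>C a j) has_sum S) UNIV"
      by (rule has_sum_SigmaD[OF swapped]) (use col in auto)
    then show ?thesis using has_sum_imp_sums S_eq by (auto simp: k_def)
  qed
  then show "\<exists>r>0. \<exists>a. \<forall>w\<in>ball w0 r. (\<lambda>j. (w - w0) ^ j *\<^sub>C a j) sums (\<Sum>n. (w - z) ^ n *\<^sub>C x n)"
    using r by blast
qed

section \<open>Finite-dimensional and finite-codimensional subspaces\<close>

abbreviation clinear :: "('a::complex_banach \<Rightarrow> 'b::complex_banach) \<Rightarrow> bool"
  where "clinear \<equiv> Vector_Spaces.linear scaleC scaleC"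

lemma trivial_Int_subspaces:
  assumes "csubspace V" "csubspace W" "\<And>x. x \<in> V \<Longrightarrow> x \<in> W \<Longrightarrow> x = 0"
  shows "V \<inter> W = {0}"
  using assms(3) complex_vector.subspace_0[OF assms(1)] complex_vector.subspace_0[OF assms(2)] by auto

text \<open>
  The coefficient of \<open>b\<close> is a continuous function on the span: by linearity it is bounded by the
  norm divided by the distance \<open>d\<close> from \<open>b\<close> to the closed subspace.
\<close>

lemma closed_cspan_insert:
  assumes cl: "closed (cspan B)"
  shows "closed (cspan (insert b B))"
proof (cases "b \<in> cspan B")
  case True
  then show ?thesis using cl complex_vector.span_redundant by metis
next
  case False
  define d where "d = infdist b (cspan B)"
  have ne: "cspan B \<noteq> {}" using complex_vector.span_zero by blast
  have d: "d > 0" unfolding d_def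
    using False cl ne by (simp add: infdist_pos_not_in_closed)
  have coeff: "cmod (k - l) * d \<le> norm (x - y)"
    if "x - k *\<^sub>C b \<in> cspan B" "y - l *\<^sub>C b \<in> cspan B" for x y k l
  proof (cases "k = l")
    case False
    define v where "v = inverse (l - k) *\<^sub>C ((x - k *\<^sub>C b) - (y - l *\<^sub>C b))"
    have "v \<in> cspan B" unfolding v_def
      by (rule complex_vector.span_scale[OF complex_vector.span_diff[OF that]])
    moreover have "v = inverse (l - k) *\<^sub>C (x - y) + b"
    proof -
      have "v = inverse (l - k) *\<^sub>C ((x - y) + (l - k) *\<^sub>C b)"
        by (simp add: v_def complex_vector.scale_left_diff_distrib algebra_simps)
      then show ?thesis using False by (simp add: scaleC_add_right scaleC_scaleC scaleC_one)
    qed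
    ultimately have "d \<le> norm (inverse (l - k) *\<^sub>C (x - y))"
      unfolding d_def using infdist_le[of v "cspan B" b] by (simp add: dist_norm)
    then have "d \<le> norm (x - y) / cmod (k - l)"
      by (simp only: norm_scaleC norm_inverse norm_minus_commute[of l k] divide_inverse mult.commute)
    then show ?thesis using False by (simp add: field_simps)
  qed simp
  show ?thesis
    unfolding closed_sequential_limits
  proof (intro allI impI, elim conjE)
    fix x l assume x: "\<forall>n. x n \<in> cspan (insert b B)" and lim: "x \<longlonglongrightarrow> l"
    have "\<forall>n. \<exists>k. x n - k *\<^sub>C b \<in> cspan B"
      using x by (simp add: complex_vector.span_breakdown_eq)
    then obtain k where k: "\<And>n. x n - k n *\<^sub>C b \<in> cspan B" by metis
    have "Cauchy k"
    proof (rule metric_CauchyI)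
      fix e :: real assume "e > 0"
      then have "e * d > 0" using d by simp
      then obtain N where N: "\<And>m n. m \<ge> N \<Longrightarrow> n \<ge> N \<Longrightarrow> dist (x m) (x n) < e * d"
        using LIMSEQ_imp_Cauchy[OF lim] unfolding Cauchy_def by meson
      have "dist (k m) (k n) < e" if "m \<ge> N" "n \<ge> N" for m n
        using le_less_trans[OF coeff[OF k k] N[OF that, unfolded dist_norm]] d
        by (simp add: dist_norm)
      then show "\<exists>N. \<forall>m\<ge>N. \<forall>n\<ge>N. dist (k m) (k n) < e" by blast
    qed
    then obtain k0 where k0: "k \<longlonglongrightarrow> k0" using Cauchy_convergent convergent_def by blast
    have "(\<lambda>n. x n - k n *\<^sub>C b) \<longlonglongrightarrow> l - k0 *\<^sub>C b"
      by (intro tendsto_diff lim bounded_bilinear.tendsto[OF bounded_bilinear_scaleC] k0 tendsto_const)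
    then have "l - k0 *\<^sub>C b \<in> cspan B" by (rule closed_sequentially[OF cl k])
    then show "l \<in> cspan (insert b B)" by (auto simp: complex_vector.span_breakdown_eq)
  qed
qed

lemma closed_cspan_finite: "finite B \<Longrightarrow> closed (cspan B)"
  by (induction rule: finite_induct) (simp_all add: closed_cspan_insert complex_vector.span_empty)

lemma cfinite_dim_basis:
  assumes "cfinite_dim V" "csubspace V"
  obtains B where "finite B" "cindependent B" "cspan B = V" "card B = cdim V"
proof -
  obtain B where B: "B \<subseteq> V" "cindependent B" "V \<subseteq> cspan B" "card B = cdim V"
    using complex_vector.basis_exists[of V] by blast
  obtain W where W: "finite W" "V \<subseteq> cspan W" using assms(1) unfolding cfinite_dim_def by blast
  have "finite B" using complex_vector.independent_span_bound[OF W(1) B(2)] B(1) W(2) by blast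
  moreover have "cspan B = V" using B assms(2) complex_vector.span_subspace by blast
  ultimately show thesis using B that by blast
qed

lemma cfinite_dim_subset: "cfinite_dim W \<Longrightarrow> V \<subseteq> W \<Longrightarrow> cfinite_dim V"
  unfolding cfinite_dim_def by blast

lemma closed_cfinite_dim: "cfinite_dim V \<Longrightarrow> csubspace V \<Longrightarrow> closed V"
  using cfinite_dim_basis closed_cspan_finite by metis

lemma csubspace_eqI_cdim:
  assumes "csubspace G" "csubspace H" "G \<subseteq> H" "cfinite_dim H" "cdim H \<le> cdim G"
  shows "G = H"
proof -
  obtain B where B: "finite B" "cindependent B" "cspan B = G" "card B = cdim G"
    using cfinite_dim_basis cfinite_dim_subset assms by metis
  have "B \<subseteq> H" using B(3) assms(3) complex_vector.span_superset by blast
  then obtain B' where B': "B \<subseteq> B'" "B' \<subseteq> H" "cindependent B'" "H \<subseteq> cspan B'"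
    using complex_vector.maximal_independent_subset_extend[of B H] B(2) by blast
  obtain W where W: "finite W" "H \<subseteq> cspan W" using assms(4) unfolding cfinite_dim_def by blast
  have "finite B'" using complex_vector.independent_span_bound[OF W(1) B'(3)] B'(2) W(2) by blast
  moreover have "card B' = cdim H" using complex_vector.dim_unique[OF B'(2,4,3) refl] by simp
  ultimately have "B = B'" using B'(1) B(4) assms(5) card_seteq by metis
  then show ?thesis using B(3) B'(4) assms(3) by blast
qed

lemma decreasing_csubspaces_stabilise:
  assumes sub: "\<And>n. csubspace (L n)" and fin: "cfinite_dim (L 0)" and dec: "\<And>n. L (Suc n) \<subseteq> L n"
  obtains d where "\<And>n. d \<le> n \<Longrightarrow> L n = L d"
proof -
  have anti: "L n \<subseteq> L m" if "m \<le> n" for m n by (rule lift_Suc_antimono_le[of L, OF dec that])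
  define d where "d = (ARG_MIN (\<lambda>n. cdim (L n)) n. True)"
  have min: "cdim (L d) \<le> cdim (L n)" for n
    unfolding d_def by (rule arg_min_nat_le) simp
  show thesis
  proof
    fix n assume "d \<le> n"
    show "L n = L d"
      by (rule csubspace_eqI_cdim[OF sub sub anti[OF \<open>d \<le> n\<close>] cfinite_dim_subset[OF fin anti] min]) simp
  qed
qed

text \<open>
  A complement of \<open>R\<close> in \<open>R + cspan B\<close> can be spanned by members of \<open>B\<close>: they are added one at a
  time, and only those that are not yet in the span reached so far.
\<close>

lemma finite_complement_exists:
  assumes R: "csubspace R" and B: "finite B"
  obtains B' where "B' \<subseteq> B" "cspan (R \<union> B') = cspan (R \<union> B)" "R \<inter> cspan B' = {0}"
proof -
  have "\<exists>B'\<subseteq>B. cspan (R \<union> B') = cspan (R \<union> B) \<and> R \<inter> cspan B' = {0}"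
    using B
  proof (induction B rule: finite_induct)
    case empty
    then show ?case using complex_vector.subspace_0[OF R]
      by (auto simp: complex_vector.span_empty)
  next
    case (insert b B)
    then obtain B' where B': "B' \<subseteq> B" "cspan (R \<union> B') = cspan (R \<union> B)" "R \<inter> cspan B' = {0}"
      using insert.IH by metis
    show ?case
    proof (cases "b \<in> cspan (R \<union> B')")
      case True
      then have "cspan (R \<union> insert b B) = cspan (R \<union> B)"
        using B'(2) complex_vector.span_redundant by (metis Un_insert_right)
      then show ?thesis using B' by blast
    next
      case False
      have "cspan (R \<union> insert b B') = cspan (R \<union> insert b B)"
      proof -
        have "cspan (insert b (R \<union> B')) = cspan (insert b (R \<union> B))"
          unfolding complex_vector.span_insert B'(2) ..
        then show ?thesis by simp
      qed
      moreover have "R \<inter> cspan (insert b B') = {0}"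
      proof (rule trivial_Int_subspaces[OF R complex_vector.subspace_span])
        fix x assume x: "x \<in> R" "x \<in> cspan (insert b B')"
        show "x = 0"
        proof -
          obtain k where k: "x - k *\<^sub>C b \<in> cspan B'"
            using x(2) by (auto simp: complex_vector.span_breakdown_eq)
          have "k = 0"
          proof (rule ccontr)
            assume "k \<noteq> 0"
            have x': "x \<in> cspan (R \<union> B')" "x - k *\<^sub>C b \<in> cspan (R \<union> B')"
              using x(1) k complex_vector.span_base complex_vector.span_mono[of B' "R \<union> B'"] by blast+
            then have "inverse k *\<^sub>C (x - (x - k *\<^sub>C b)) \<in> cspan (R \<union> B')"
              using complex_vector.span_scale[OF complex_vector.span_diff[OF x']] by blast
            then show False using False \<open>k \<noteq> 0\<close> by (simp add: scaleC_scaleC scaleC_one)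
          qed
          then show "x = 0" using k x(1) B'(3) by auto
        qed
      qed
      moreover have "insert b B' \<subseteq> insert b B" using B'(1) by (rule insert_mono)
      ultimately show ?thesis by (intro exI[of _ "insert b B'"] conjI)
    qed
  qed
  then show thesis by (elim exE conjE) (rule that)
qed

text \<open>
  For finite codimension it is enough to have a finite-dimensional supplement \<open>G\<close> that may
  meet \<open>R\<close>; the powers of an operator produce such supplements.
\<close>

lemma finite_codim_inI:
  assumes R: "csubspace R" and G: "csubspace G" "cfinite_dim G"
    and M: "M = {x + y | x y. x \<in> R \<and> y \<in> G}"
  shows "finite_codim_in M R"
proof -
  obtain B where B: "finite B" "cspan B = G" using cfinite_dim_basis[OF G(2,1)] by blast
  obtain B' where B': "B' \<subseteq> B" "cspan (R \<union> B') = cspan (R \<union> B)" "R \<inter> cspan B' = {0}"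
    using finite_complement_exists[OF R B(1)] by blast
  have "{x + y | x y. x \<in> R \<and> y \<in> cspan B'} = M"
    using B'(2) unfolding complex_vector.span_Un B(2) M complex_vector.span_eq_iff[THEN iffD2, OF R] .
  then have "fin_complement_in M R (cspan B')"
    unfolding fin_complement_in_def direct_sum_def cfinite_dim_def
    using B'(1,3) finite_subset[OF B'(1) B(1)] by auto
  then show ?thesis unfolding finite_codim_in_def by blast
qed

text \<open>
  If \<open>R + G\<close> were smaller than \<open>M\<close>, then a nonzero complement of it added to \<open>G\<close> would be a
  complement of \<open>R\<close> of dimension greater than \<open>cdim F\<close>; but all complements of \<open>R\<close> have the same
  dimension.
\<close>

lemma complement_of_full_dimension:
  assumes R: "csubspace R" and F: "fin_complement_in M R F" and M: "csubspace M"
    and G: "csubspace G" "cfinite_dim G" "G \<subseteq> M" "R \<inter> G = {0}" "cdim F \<le> cdim G"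
  shows "M = {x + y | x y. x \<in> R \<and> y \<in> G}"
proof -
  have sF: "csubspace F" and fF: "cfinite_dim F" and MF: "{x + y | x y. x \<in> R \<and> y \<in> F} = M"
    using F by (auto simp: fin_complement_in_def direct_sum_def)
  define R' where "R' = {x + y | x y. x \<in> R \<and> y \<in> G}"
  have sR': "csubspace R'" unfolding R'_def by (rule complex_vector.subspace_sums[OF R G(1)])
  obtain B where B: "finite B" "cspan B = F" using cfinite_dim_basis[OF fF sF] by blast
  obtain B' where B': "B' \<subseteq> B" "cspan (R' \<union> B') = cspan (R' \<union> B)" "R' \<inter> cspan B' = {0}"
    using finite_complement_exists[OF sR' B(1)] by blast
  have RM: "R \<subseteq> M" using MF complex_vector.subspace_0[OF sF] by force
  have FM: "F \<subseteq> M" using MF complex_vector.subspace_0[OF R] by force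
  have RR': "R \<subseteq> R'" unfolding R'_def using complex_vector.subspace_0[OF G(1)] by force
  have GR': "G \<subseteq> R'" unfolding R'_def using complex_vector.subspace_0[OF R] by force
  have R'M: "R' \<subseteq> M" unfolding R'_def using RM G(3) complex_vector.subspace_add[OF M] by blast
  note spR' = complex_vector.span_eq_iff[THEN iffD2, OF sR']
  have "cspan (R' \<union> B) = {x + y | x y. x \<in> R' \<and> y \<in> F}"
    unfolding complex_vector.span_Un spR' B(2) ..
  also have "\<dots> = M"
    using MF R'M FM RR' complex_vector.subspace_add[OF M] by blast
  finally have M_eq: "{x + y | x y. x \<in> R' \<and> y \<in> cspan B'} = M"
    using B'(2) unfolding complex_vector.span_Un[of _ B'] spR' by simp
  define H where "H = {x + y | x y. x \<in> G \<and> y \<in> cspan B'}"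
  have sH: "csubspace H" unfolding H_def by (intro complex_vector.subspace_sums G(1)) simp
  have GH: "G \<subseteq> H" unfolding H_def using complex_vector.span_zero by force
  have fH: "cfinite_dim H"
  proof -
    obtain C where C: "finite C" "cspan C = G" using cfinite_dim_basis[OF G(2,1)] by blast
    have "H = cspan (C \<union> B')" unfolding H_def complex_vector.span_Un C(2) ..
    then show ?thesis unfolding cfinite_dim_def
      using C(1) B(1) B'(1) finite_subset by (metis finite_UnI order_refl)
  qed
  have "R \<inter> H = {0}"
  proof (rule trivial_Int_subspaces[OF R sH])
    fix r assume r: "r \<in> R" "r \<in> H"
    show "r = 0"
    proof -
      obtain g s where gs: "g \<in> G" "s \<in> cspan B'" "r = g + s" using r(2) unfolding H_def by blast
      then have "s = r - g" by simp
      then have "s \<in> R'" using r(1) gs(1) RR' GR' complex_vector.subspace_diff[OF sR'] by blast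
      then have "s = 0" using gs(2) B'(3) by blast
      then show "r = 0" using gs r(1) G(4) by auto
    qed
  qed
  moreover have "{x + y | x y. x \<in> R \<and> y \<in> H} = M"
  proof -
    have "{x + y | x y. x \<in> R \<and> y \<in> H} = {x + y | x y. x \<in> R' \<and> y \<in> cspan B'}"
      unfolding H_def R'_def by (auto simp: add.assoc) (metis add.assoc)+
    then show ?thesis using M_eq by simp
  qed
  ultimately have "fin_complement_in M R H"
    unfolding fin_complement_in_def direct_sum_def using sH fH by blast
  from fin_complement_cdim_le[OF R this F] have "cdim H \<le> cdim G" using G(5) by simp
  then have "G = H" by (rule csubspace_eqI_cdim[OF G(1) sH GH fH])
  then have "cspan B' \<subseteq> G" unfolding H_def using complex_vector.subspace_0[OF G(1)] by force
  then have "cspan B' \<subseteq> {0}" using GR' B'(3) by blast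
  then have "M = R'" using M_eq complex_vector.span_zero[of B'] by force
  then show ?thesis by (simp add: R'_def)
qed

text \<open>
  Both expansions of a common vector are its unique expansion in \<open>B\<close>, so its coefficients vanish
  outside \<open>A\<close> as well as on \<open>A\<close>.
\<close>

lemma independent_span_Int_Diff:
  assumes "cindependent B" "A \<subseteq> B"
  shows "cspan A \<inter> cspan (B - A) = {0}"
proof (rule trivial_Int_subspaces[OF complex_vector.subspace_span complex_vector.subspace_span])
  fix x assume x: "x \<in> cspan A" "x \<in> cspan (B - A)"
  show "x = 0"
  proof -
    have "complex_vector.representation B x = complex_vector.representation A x"
      "complex_vector.representation B x = complex_vector.representation (B - A) x"
      using assms x by (intro complex_vector.representation_extend; blast)+
    then have "complex_vector.representation B x b = 0" for b
      using complex_vector.representation_ne_zero by (metis DiffD2)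
    moreover have "x \<in> cspan B" using x(1) assms(2) complex_vector.span_mono by blast
    ultimately show "x = 0"
      using complex_vector.sum_nonzero_representation_eq[OF assms(1), of x] by simp
  qed
qed

lemma clinear_simps:
  fixes f :: "'a::complex_banach \<Rightarrow> 'b::complex_banach"
  assumes "clinear f"
  shows "f (x + y) = f x + f y" "f (x - y) = f x - f y" "f (c *\<^sub>C x) = c *\<^sub>C f x" "f 0 = 0"
proof -
  interpret Vector_Spaces.linear "scaleC :: complex \<Rightarrow> 'a \<Rightarrow> 'a" "scaleC :: complex \<Rightarrow> 'b \<Rightarrow> 'b" f by (rule assms)
  show "f (x + y) = f x + f y" "f (x - y) = f x - f y" "f (c *\<^sub>C x) = c *\<^sub>C f x" "f 0 = 0"
    by (rule add diff scale zero)+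
qed

lemma clinear_image:
  fixes f :: "'a::complex_banach \<Rightarrow> 'b::complex_banach"
  assumes "clinear f"
  shows csubspace_image: "csubspace V \<Longrightarrow> csubspace (f ` V)"
    and cspan_image: "cspan (f ` B) = f ` cspan B"
    and cindependent_image: "cindependent B \<Longrightarrow> inj_on f (cspan B) \<Longrightarrow> cindependent (f ` B)"
proof -
  interpret Vector_Spaces.linear "scaleC :: complex \<Rightarrow> 'a \<Rightarrow> 'a" "scaleC :: complex \<Rightarrow> 'b \<Rightarrow> 'b" f by (rule assms)
  show "csubspace V \<Longrightarrow> csubspace (f ` V)" unfolding csubspace_def by (rule subspace_image)
  show "cspan (f ` B) = f ` cspan B" unfolding cspan_def by (rule span_image)
  show "cindependent B \<Longrightarrow> inj_on f (cspan B) \<Longrightarrow> cindependent (f ` B)"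
    unfolding cdependent_def cspan_def by (rule independent_injective_image)
qed

text \<open>
  Rank-nullity for an endomorphism of a finite-dimensional space, in the form that the image has
  a complement of the dimension of the kernel. A basis of \<open>Q\<close> through a basis \<open>K\<close> of the kernel
  and a basis of \<open>Q\<close> through the image of the remaining vectors \<open>E\<close> have the same size, so their
  leftovers \<open>K\<close> and \<open>G\<close> have the same size too.
\<close>

lemma rank_nullity_complement:
  assumes f: "clinear f" and Q: "csubspace Q" "cfinite_dim Q" and inv: "f ` Q \<subseteq> Q"
  obtains G where "fin_complement_in Q (f ` Q) G" "cdim G = cdim (kernel_on Q f)"
proof -
  note fs = clinear_simps[OF f]
  have K_sub: "csubspace (kernel_on Q f)"
    unfolding kernel_on_def using Q(1) fs
    by (auto intro!: complex_vector.subspaceI simp: complex_vector.subspace_0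
        complex_vector.subspace_add complex_vector.subspace_scale)
  have KQ: "kernel_on Q f \<subseteq> Q" by (auto simp: kernel_on_def)
  obtain K where K: "finite K" "cindependent K" "cspan K = kernel_on Q f" "card K = cdim (kernel_on Q f)"
    using cfinite_dim_basis[OF cfinite_dim_subset[OF Q(2) KQ] K_sub] by blast
  have dimQ: "finite B \<and> cspan B = Q \<and> card B = cdim Q" if "cindependent B" "B \<subseteq> Q" "Q \<subseteq> cspan B" for B
  proof -
    obtain W where W: "finite W" "Q \<subseteq> cspan W" using Q(2) unfolding cfinite_dim_def by blast
    have "finite B"
      using complex_vector.independent_span_bound[OF W(1) that(1) order_trans[OF that(2) W(2)]] by simp
    then show ?thesis
      using complex_vector.dim_unique[OF that(2,3,1) refl] complex_vector.span_subspace[OF that(2,3) Q(1)]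
      by simp
  qed
  have "K \<subseteq> Q" using K(3) KQ complex_vector.span_superset by blast
  then obtain B where B: "K \<subseteq> B" "B \<subseteq> Q" "cindependent B" "Q \<subseteq> cspan B"
    using complex_vector.maximal_independent_subset_extend[of K Q] K(2) by blast
  note fB = dimQ[OF B(3,2,4)]
  define E where "E = B - K"
  have EQ: "cspan E \<subseteq> Q" using complex_vector.span_mono[of E B] fB by (auto simp: E_def)
  have trivial: "x = 0" if "x \<in> cspan E" "f x = 0" for x
  proof -
    have "x \<in> cspan K" unfolding K(3) kernel_on_def using that EQ by blast
    then show "x = 0" using independent_span_Int_Diff[OF B(3,1)] that(1) unfolding E_def by blast
  qed
  have inj: "inj_on f (cspan E)"
  proof (rule inj_onI)
    fix x y assume "x \<in> cspan E" "y \<in> cspan E" "f x = f y"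
    then show "x = y" using trivial[of "x - y"] complex_vector.span_diff fs(2) by auto
  qed
  have indE: "cindependent (f ` E)"
    using cindependent_image[OF f _ inj] complex_vector.independent_mono[OF B(3)] unfolding E_def by blast
  have imE: "cspan (f ` E) = f ` Q"
  proof -
    have "f x \<in> f ` cspan E" if "x \<in> Q" for x
    proof -
      have "x \<in> cspan (K \<union> E)" using that B(1,4) by (auto simp: E_def Un_absorb1)
      then obtain u v where "u \<in> cspan K" "v \<in> cspan E" "x = u + v" unfolding complex_vector.span_Un by blast
      then show ?thesis using K(3) by (auto simp: kernel_on_def fs)
    qed
    then show ?thesis unfolding cspan_image[OF f] using EQ by blast
  qed
  have "f ` E \<subseteq> Q" using order_trans[OF complex_vector.span_superset[of "f ` E"]] imE inv by simp
  then obtain B2 where B2: "f ` E \<subseteq> B2" "B2 \<subseteq> Q" "cindependent B2" "Q \<subseteq> cspan B2"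
    using complex_vector.maximal_independent_subset_extend[of "f ` E" Q] indE by blast
  note fB2 = dimQ[OF B2(3,2,4)]
  define G where "G = B2 - f ` E"
  have "card (f ` E) = card E"
    using inj complex_vector.span_superset by (intro card_image) (rule inj_on_subset)
  then have "card G = card K"
    unfolding G_def E_def using fB fB2 B(1) B2(1) K(1) card_mono[of B K]
    by (simp add: card_Diff_subset finite_subset E_def)
  moreover have "cindependent G" using complex_vector.independent_mono[OF B2(3)] unfolding G_def by blast
  ultimately have "cdim (cspan G) = cdim (kernel_on Q f)"
    using K(4) complex_vector.dim_span_eq_card_independent[of G] by metis
  moreover have "fin_complement_in Q (f ` Q) (cspan G)"
    unfolding fin_complement_in_def direct_sum_def cfinite_dim_def
  proof (intro conjI)
    show "\<exists>B. finite B \<and> cspan G \<subseteq> cspan B"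
      using fB2 by (intro exI[of _ G]) (simp add: G_def)
    show "f ` Q \<inter> cspan G = {0}"
      using independent_span_Int_Diff[OF B2(3,1)] unfolding imE G_def .
    have "cspan (f ` E \<union> G) = Q" using B2(1) fB2 by (simp add: G_def Un_absorb1)
    then show "{x + y |x y. x \<in> f ` Q \<and> y \<in> cspan G} = Q"
      unfolding complex_vector.span_Un imE .
  qed simp
  ultimately show thesis using that by blast
qed

lemma cfinite_dim_of_kernel_and_image:
  assumes f: "clinear f" and V: "csubspace V"
    and ker: "cfinite_dim (kernel_on V f)" and img: "cfinite_dim (f ` V)"
  shows "cfinite_dim V"
proof -
  note fs = clinear_simps[OF f]
  obtain K where K: "finite K" "kernel_on V f \<subseteq> cspan K" using ker unfolding cfinite_dim_def by blast
  obtain B where B: "finite B" "cspan B = f ` V"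
    using cfinite_dim_basis[OF img csubspace_image[OF f V]] by metis
  then have "\<forall>b\<in>B. \<exists>v\<in>V. f v = b" using complex_vector.span_base by (metis imageE)
  then obtain p where p: "\<And>b. b \<in> B \<Longrightarrow> p b \<in> V \<and> f (p b) = b" by metis
  have pV: "cspan (p ` B) \<subseteq> V" using p V by (intro complex_vector.span_minimal) auto
  have "f ` p ` B = B" using p by force
  then have im: "f ` cspan (p ` B) = f ` V" using cspan_image[OF f, of "p ` B"] B(2) by simp
  have "V \<subseteq> cspan (K \<union> p ` B)"
  proof
    fix v assume v: "v \<in> V"
    then have "f v \<in> f ` cspan (p ` B)" using im by blast
    then obtain u where u: "u \<in> cspan (p ` B)" "f v = f u" by blast
    have "v - u \<in> kernel_on V f"
      using v u pV complex_vector.subspace_diff[OF V] by (auto simp: kernel_on_def fs)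
    then have "(v - u) + u \<in> cspan (K \<union> p ` B)" unfolding complex_vector.span_Un using K(2) u(1) by blast
    then show "v \<in> cspan (K \<union> p ` B)" by simp
  qed
  then show ?thesis unfolding cfinite_dim_def using K(1) B(1) by (intro exI[of _ "K \<union> p ` B"]) simp
qed

lemma csubspace_imp_subspace: "csubspace V \<Longrightarrow> subspace (V :: 'a::complex_banach set)"
  using complex_vector.subspace_0 complex_vector.subspace_add complex_vector.subspace_scale
  by (metis (no_types, lifting) subspaceI scaleC_of_real)

lemma clinearI:
  fixes f :: "'a::complex_banach \<Rightarrow> 'b::complex_banach"
  assumes "\<And>x y. f (x + y) = f x + f y" "\<And>c x. f (c *\<^sub>C x) = c *\<^sub>C f x"
  shows "clinear f"
  unfolding Vector_Spaces.linear_iff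
  by (intro conjI allI complex_vector.vector_space_axioms assms)

lemma cfinite_dim_sum:
  assumes "cfinite_dim V" "cfinite_dim W"
  shows "cfinite_dim {x + y | x y. x \<in> V \<and> y \<in> W}"
proof -
  obtain B C where "finite B" "V \<subseteq> cspan B" "finite C" "W \<subseteq> cspan C"
    using assms unfolding cfinite_dim_def by blast
  then show ?thesis unfolding cfinite_dim_def
    by (intro exI[of _ "B \<union> C"]) (auto simp: complex_vector.span_Un)
qed

lemma cfinite_dim_image:
  assumes "clinear f" "cfinite_dim V"
  shows "cfinite_dim (f ` V)"
proof -
  obtain B where "finite B" "V \<subseteq> cspan B" using assms(2) unfolding cfinite_dim_def by blast
  then show ?thesis unfolding cfinite_dim_def
    by (intro exI[of _ "f ` B"]) (auto simp: cspan_image[OF assms(1)])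
qed

lemma direct_sumI:
  assumes "V \<inter> W = {0}" "\<And>x y. x \<in> V \<Longrightarrow> y \<in> W \<Longrightarrow> x + y \<in> M"
    "\<And>m. m \<in> M \<Longrightarrow> \<exists>x\<in>V. \<exists>y\<in>W. m = x + y"
  shows "direct_sum V W M"
proof -
  have "m \<in> {x + y | x y. x \<in> V \<and> y \<in> W} \<longleftrightarrow> m \<in> M" for m
    using assms(2,3) by (smt (verit) mem_Collect_eq)
  then show ?thesis unfolding direct_sum_def using assms(1) by auto
qed

lemma direct_sumD:
  assumes "csubspace V" "csubspace W" "direct_sum V W M"
  shows "V \<inter> W = {0}" "x \<in> V \<Longrightarrow> y \<in> W \<Longrightarrow> x + y \<in> M"
    "m \<in> M \<Longrightarrow> \<exists>x\<in>V. \<exists>y\<in>W. m = x + y" "V \<subseteq> M" "W \<subseteq> M"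
proof -
  note V0 = complex_vector.subspace_0[OF assms(1)] and W0 = complex_vector.subspace_0[OF assms(2)]
  have M: "M = {x + y | x y. x \<in> V \<and> y \<in> W}" using assms(3) by (simp add: direct_sum_def)
  show sum: "x + y \<in> M" if "x \<in> V" "y \<in> W" for x y unfolding M using that by blast
  show "V \<inter> W = {0}" using assms(3) by (simp add: direct_sum_def)
  show "m \<in> M \<Longrightarrow> \<exists>x\<in>V. \<exists>y\<in>W. m = x + y" unfolding M by blast
  show "V \<subseteq> M" using sum[OF _ W0] by auto
  show "W \<subseteq> M" using sum[OF V0] by auto
qed

lemma direct_sum_unique:
  assumes "csubspace V" "csubspace W" "V \<inter> W = {0}"
    and "x \<in> V" "x' \<in> V" "y \<in> W" "y' \<in> W" "x + y = x' + y'"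
  shows "x = x' \<and> y = y'"
proof -
  have "x - x' = y' - y" using assms(8) by (simp add: algebra_simps)
  then have "x - x' \<in> V \<inter> W"
    using complex_vector.subspace_diff[OF assms(1,4,5)] complex_vector.subspace_diff[OF assms(2,7,6)] by simp
  then show ?thesis using assms(3,8) by auto
qed

lemma bij_betw_sum_of_subspaces:
  assumes f: "clinear f" and V: "csubspace V" and W: "csubspace W" and Int: "V \<inter> W = {0}"
    and bV: "bij_betw f V V" and bW: "bij_betw f W W"
  shows "bij_betw f {x + y | x y. x \<in> V \<and> y \<in> W} {x + y | x y. x \<in> V \<and> y \<in> W}"
proof -
  note lin = clinear_simps[OF f]
  have fV: "f x \<in> V" if "x \<in> V" for x using bij_betw_apply[OF bV that] .
  have fW: "f y \<in> W" if "y \<in> W" for y using bij_betw_apply[OF bW that] .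
  show ?thesis
    unfolding bij_betw_def
  proof
    show "inj_on f {x + y | x y. x \<in> V \<and> y \<in> W}"
    proof (rule inj_onI, clarify)
      fix x y x' y'
      assume xy: "x \<in> V" "y \<in> W" "x' \<in> V" "y' \<in> W" "f (x + y) = f (x' + y')"
      have "f x = f x' \<and> f y = f y'"
        by (rule direct_sum_unique[OF V W Int]) (use xy fV fW in \<open>auto simp: lin\<close>)
      then show "x + y = x' + y'"
        using bij_betw_imp_inj_on[OF bV] bij_betw_imp_inj_on[OF bW] xy(1-4) by (metis inj_onD)
    qed
    show "f ` {x + y | x y. x \<in> V \<and> y \<in> W} = {x + y | x y. x \<in> V \<and> y \<in> W}"
    proof
      show "{x + y | x y. x \<in> V \<and> y \<in> W} \<subseteq> f ` {x + y | x y. x \<in> V \<and> y \<in> W}"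
      proof clarify
        fix x y assume "x \<in> V" "y \<in> W"
        then obtain a b where "a \<in> V" "f a = x" "b \<in> W" "f b = y"
          using bij_betw_imp_surj_on[OF bV] bij_betw_imp_surj_on[OF bW] by (metis imageE)
        then show "x + y \<in> f ` {x + y | x y. x \<in> V \<and> y \<in> W}"
          by (intro image_eqI[of _ _ "a + b"]) (auto simp: lin)
      qed
      show "f ` {x + y | x y. x \<in> V \<and> y \<in> W} \<subseteq> {x + y | x y. x \<in> V \<and> y \<in> W}"
        using fV fW by (fastforce simp: lin)
    qed
  qed
qed

section \<open>Closedness of sums\<close>

text \<open>
  By the open mapping theorem for the sum map on \<open>M \<times> N\<close>, the \<open>M\<close>-component of a vector depends
  continuously on it. So the \<open>M\<close>-components of a convergent sequence in \<open>K + N\<close> converge, and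
  their limit lies in \<open>K\<close>.
\<close>

lemma closed_sum_of_closed_summand:
  fixes M N K :: "'a::complex_banach set"
  assumes M: "closed_csubspace M" and N: "closed_csubspace N" and MN: "direct_sum M N UNIV"
    and K: "closed K" "K \<subseteq> M"
  shows "closed {x + y | x y. x \<in> K \<and> y \<in> N}"
proof -
  have M': "csubspace M" "closed M" and N': "csubspace N" "closed N"
    using M N by (auto simp: closed_csubspace_def)
  have Int: "M \<inter> N = {0}" using MN by (simp add: direct_sum_def)
  have bl: "bounded_linear (\<lambda>p::'a \<times> 'a. fst p + snd p)"
    by (intro bounded_linear_add bounded_linear_fst bounded_linear_snd)
  have sub: "subspace (M \<times> N)"
    using M'(1) N'(1) by (intro subspace_Times csubspace_imp_subspace)
  have cl: "closed (M \<times> N)" using M' N' by (intro closed_Times)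
  have im: "(\<lambda>p. fst p + snd p) ` (M \<times> N) = UNIV"
  proof -
    have "y \<in> (\<lambda>p. fst p + snd p) ` (M \<times> N)" for y
    proof -
      have "y \<in> {x + y | x y. x \<in> M \<and> y \<in> N}" using MN by (simp add: direct_sum_def)
      then show ?thesis by force
    qed
    then show ?thesis by blast
  qed
  obtain C where C: "C > 0" "\<And>y. \<exists>p\<in>M \<times> N. fst p + snd p = y \<and> norm p \<le> C * norm y"
    using open_mapping_on_closed_subspace[OF bl sub cl closed_UNIV im] by (metis UNIV_I)
  show ?thesis
    unfolding closed_sequential_limits
  proof (intro allI impI, elim conjE)
    fix s l assume s: "\<forall>n. s n \<in> {x + y | x y. x \<in> K \<and> y \<in> N}" and lim: "s \<longlonglongrightarrow> l"
    have "\<forall>n. \<exists>x y. x \<in> K \<and> y \<in> N \<and> s n = x + y" using s by blast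
    then obtain a b where ab: "\<And>n. a n \<in> K" "\<And>n. b n \<in> N" "\<And>n. s n = a n + b n" by metis
    obtain p where p: "p \<in> M \<times> N" "fst p + snd p = l" using C(2) by blast
    have "\<forall>n. \<exists>q\<in>M \<times> N. fst q + snd q = s n - l \<and> norm q \<le> C * norm (s n - l)" using C(2) by blast
    then obtain q where q: "\<And>n. q n \<in> M \<times> N" "\<And>n. fst (q n) + snd (q n) = s n - l"
      "\<And>n. norm (q n) \<le> C * norm (s n - l)" by metis
    have eq: "a n = fst p + fst (q n)" for n
    proof -
      have "fst p + fst (q n) \<in> M" "snd p + snd (q n) \<in> N"
        using p(1) q(1)[of n] M'(1) N'(1) by (auto simp: mem_Times_iff complex_vector.subspace_add)
      moreover have "a n + b n = (fst p + fst (q n)) + (snd p + snd (q n))"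
        using q(2)[of n] p(2) ab(3)[of n] by (simp add: algebra_simps) (metis add.assoc)
      ultimately show ?thesis using direct_sum_unique[OF M'(1) N'(1) Int] ab(1,2)[of n] K(2) by blast
    qed
    have "(\<lambda>n. C * norm (s n - l)) \<longlonglongrightarrow> C * norm (l - l)" by (intro tendsto_intros lim)
    then have "(\<lambda>n. C * norm (s n - l)) \<longlonglongrightarrow> 0" by simp
    then have "(\<lambda>n. q n) \<longlonglongrightarrow> 0" by (rule Lim_null_comparison[rotated]) (simp add: q(3))
    then have "a \<longlonglongrightarrow> fst p + fst (0 :: 'a \<times> 'a)" unfolding eq[abs_def] by (intro tendsto_intros)
    then have "fst p \<in> K" using closed_sequentially[OF K(1) ab(1)] by simp
    then show "l \<in> {x + y | x y. x \<in> K \<and> y \<in> N}" using p by (auto simp: mem_Times_iff)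
  qed
qed

section \<open>Operators on a closed invariant subspace\<close>

text \<open>
  The operator is defined on the whole space, so that its powers and its shifts by scalars are of
  the same kind; the subspace is the one to which all statements are relativised.
\<close>

locale operator_on_closed_subspace =
  fixes S :: "'a::complex_banach \<Rightarrow> 'a" and M :: "'a set"
  assumes bounded_linear: "bounded_linear S" and clinear: "clinear S"
    and closed_csubspace: "closed_csubspace M" and invariant: "invariant_under S M"
begin

lemma csubspace: "csubspace M" and closed: "closed M"
  using closed_csubspace by (auto simp: closed_csubspace_def)

lemma mem: "x \<in> M \<Longrightarrow> S x \<in> M"
  using invariant by (auto simp: invariant_under_def)

lemmas lin = clinear_simps[OF clinear]

lemma power: "operator_on_closed_subspace (S ^^ n) M"
proof (rule operator_on_closed_subspace.intro)
  show "bounded_linear (S ^^ n)"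
  proof (induction n)
    case (Suc n) then show ?case
      using bounded_linear_compose[OF bounded_linear] by (simp add: o_def)
  qed (simp add: id_def)
  show "clinear (S ^^ n)"
    by (induction n) (auto intro!: clinearI simp: clinear_simps lin)
  show "invariant_under (S ^^ n) M"
    by (induction n) (auto simp: invariant_under_def mem image_subset_iff)
qed (rule closed_csubspace)

lemma shift: "operator_on_closed_subspace (\<lambda>x. S x - z *\<^sub>C x) M"
proof (rule operator_on_closed_subspace.intro)
  show "bounded_linear (\<lambda>x. S x - z *\<^sub>C x)"
    by (intro bounded_linear_sub bounded_linear
        bounded_bilinear.bounded_linear_right[OF bounded_bilinear_scaleC])
  show "clinear (\<lambda>x. S x - z *\<^sub>C x)"
    by (rule clinearI) (simp_all add: lin scaleC_add_right scaleC_scaleC mult.commute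
        complex_vector.scale_right_diff_distrib algebra_simps)
  show "invariant_under (\<lambda>x. S x - z *\<^sub>C x) M"
    using mem csubspace
    by (auto simp: invariant_under_def intro!: complex_vector.subspace_diff complex_vector.subspace_scale)
qed (rule closed_csubspace)

lemma power_mem: "x \<in> M \<Longrightarrow> (S ^^ n) x \<in> M"
  using operator_on_closed_subspace.mem[OF power] .

lemmas power_lin = clinear_simps[OF operator_on_closed_subspace.clinear[OF power]]

lemma csubspace_range: "csubspace ((S ^^ n) ` M)"
  by (rule csubspace_image[OF operator_on_closed_subspace.clinear[OF power] csubspace])

lemma range_subset: "(S ^^ n) ` M \<subseteq> M"
  using power_mem by blast

lemma range_Suc_subset: "(S ^^ Suc n) ` M \<subseteq> (S ^^ n) ` M"
  unfolding funpow_Suc_right using mem by auto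

lemma csubspace_kernel: "csubspace (kernel_on M S)"
  unfolding kernel_on_def using csubspace lin
  by (auto intro!: complex_vector.subspaceI simp: complex_vector.subspace_0
      complex_vector.subspace_add complex_vector.subspace_scale)

lemma closed_kernel: "closed (kernel_on M S)"
proof -
  have "closed {x. S x = 0}"
    by (intro closed_Collect_eq continuous_on_const linear_continuous_on bounded_linear)
  then have "closed (M \<inter> {x. S x = 0})" by (rule closed_Int[OF closed])
  moreover have "M \<inter> {x. S x = 0} = kernel_on M S" by (auto simp: kernel_on_def)
  ultimately show ?thesis by simp
qed

text \<open>
  The map \<open>(x, f) \<mapsto> S x + f\<close> from \<open>M \<times> F\<close> onto \<open>M\<close> is open, where \<open>F\<close> is a finite-dimensional
  complement of the range. If a sequence in the range converges to \<open>l = r + f\<close>, then its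
  difference to \<open>l\<close> has the constant \<open>F\<close>-component \<open>- f\<close>, and openness bounds that component by a
  null sequence.
\<close>

lemma closed_range_of_finite_codim:
  assumes "finite_codim_in M (S ` M)"
  shows "closed (S ` M)"
proof -
  obtain F where F: "csubspace F" "cfinite_dim F" "direct_sum (S ` M) F M"
    using assms unfolding finite_codim_in_def fin_complement_in_def by blast
  have sR: "csubspace (S ` M)" by (rule csubspace_image[OF clinear csubspace])
  have Int: "S ` M \<inter> F = {0}" using F(3) by (simp add: direct_sum_def)
  have clF: "closed F" by (rule closed_cfinite_dim[OF F(2,1)])
  note ds = direct_sumD[OF sR F(1,3)]
  let ?h = "\<lambda>p::'a \<times> 'a. S (fst p) + snd p"
  have bl: "bounded_linear ?h"
    by (intro bounded_linear_add bounded_linear_snd bounded_linear_compose[OF bounded_linear] bounded_linear_fst)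
  have sub: "subspace (M \<times> F)" using csubspace F(1) by (intro subspace_Times csubspace_imp_subspace)
  have cl: "closed (M \<times> F)" by (intro closed_Times closed clF)
  have im: "?h ` (M \<times> F) = M"
  proof
    show "M \<subseteq> ?h ` (M \<times> F)"
    proof
      fix m assume "m \<in> M"
      then obtain x y where "x \<in> M" "y \<in> F" "m = S x + y" using ds(3) by blast
      then show "m \<in> ?h ` (M \<times> F)" by force
    qed
    show "?h ` (M \<times> F) \<subseteq> M" using ds(2) by auto
  qed
  obtain C where C: "C > 0"
    "\<And>y. y \<in> M \<Longrightarrow> \<exists>p\<in>M \<times> F. S (fst p) + snd p = y \<and> norm p \<le> C * norm y"
    using open_mapping_on_closed_subspace[OF bl sub cl closed im] by blast
  show ?thesis
    unfolding closed_sequential_limits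
  proof (intro allI impI, elim conjE)
    fix s l assume s: "\<forall>n. s n \<in> S ` M" and lim: "s \<longlonglongrightarrow> l"
    have sM: "s n \<in> M" for n using s ds(4) by blast
    then have lM: "l \<in> M" using closed_sequentially[OF closed _ lim] by blast
    have "\<exists>r\<in>S ` M. \<exists>f\<in>F. l = r + f" by (rule ds(3)[OF lM])
    then obtain r f where rf: "r \<in> S ` M" "f \<in> F" "l = r + f" by metis
    have "\<forall>n. \<exists>p\<in>M \<times> F. S (fst p) + snd p = s n - l \<and> norm p \<le> C * norm (s n - l)"
      using C(2) complex_vector.subspace_diff[OF csubspace sM lM] by simp
    then obtain q where q: "\<And>n. q n \<in> M \<times> F" "\<And>n. S (fst (q n)) + snd (q n) = s n - l"
      "\<And>n. norm (q n) \<le> C * norm (s n - l)" by metis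
    have eq: "snd (q n) = - f" for n
    proof -
      have "S (fst (q n)) \<in> S ` M" "snd (q n) \<in> F" using q(1)[of n] by (auto simp: mem_Times_iff)
      moreover have "s n - r \<in> S ` M" "- f \<in> F"
        using s rf complex_vector.subspace_diff[OF sR] complex_vector.subspace_neg[OF F(1)] by blast+
      moreover have "S (fst (q n)) + snd (q n) = (s n - r) + (- f)" using q(2)[of n] rf(3) by simp
      ultimately show ?thesis using direct_sum_unique[OF sR F(1) Int] by blast
    qed
    have "(\<lambda>n. C * norm (s n - l)) \<longlonglongrightarrow> C * norm (l - l)" by (intro tendsto_intros lim)
    then have "(\<lambda>n. C * norm (s n - l)) \<longlonglongrightarrow> 0" by simp
    then have "(\<lambda>n. q n) \<longlonglongrightarrow> 0" by (rule Lim_null_comparison[rotated]) (simp add: q(3))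
    then have "(\<lambda>n. snd (q n)) \<longlonglongrightarrow> snd (0 :: 'a \<times> 'a)" by (rule tendsto_snd)
    then have "f = 0" unfolding eq by (simp add: LIMSEQ_const_iff)
    then show "l \<in> S ` M" using rf by simp
  qed
qed

lemma invertible_on_if_bij:
  assumes "bij_betw S M M"
  shows "invertible_on M S"
proof -
  have inj: "inj_on S M" and im: "S ` M = M" using assms by (auto simp: bij_betw_def)
  define R where "R = inv_into M S"
  have R: "R y \<in> M" "S (R y) = y" if "y \<in> M" for y
    using that im unfolding R_def by (auto intro: inv_into_into f_inv_into_f)
  have RS: "R (S x) = x" if "x \<in> M" for x unfolding R_def by (rule inv_into_f_f[OF inj that])
  have R_eq: "R y = x" if "x \<in> M" "S x = y" for x y using RS that by blast
  obtain C where C: "C > 0" "\<And>y. y \<in> M \<Longrightarrow> \<exists>x\<in>M. S x = y \<and> norm x \<le> C * norm y"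
    using open_mapping_on_closed_subspace[OF bounded_linear csubspace_imp_subspace[OF csubspace] closed closed im]
    by blast
  have "bounded_op_on M R"
    unfolding bounded_op_on_def
  proof (intro conjI ballI allI)
    show "invariant_under R M" using R by (auto simp: invariant_under_def)
    show "R (x + y) = R x + R y" if "x \<in> M" "y \<in> M" for x y
      using that R by (intro R_eq) (simp_all add: complex_vector.subspace_add[OF csubspace] lin)
    show "R (c *\<^sub>C x) = c *\<^sub>C R x" if "x \<in> M" for c x
      using that R by (intro R_eq) (simp_all add: complex_vector.subspace_scale[OF csubspace] lin)
    show "\<exists>K. \<forall>x\<in>M. norm (R x) \<le> K * norm x" using C(2) R_eq by blast
  qed
  then show ?thesis unfolding invertible_on_def using R RS by blast
qed

lemma bij_if_invertible_on:
  assumes "invertible_on M S"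
  shows "bij_betw S M M"
proof -
  obtain R where R: "bounded_op_on M R" "\<And>x. x \<in> M \<Longrightarrow> R (S x) = x" "\<And>x. x \<in> M \<Longrightarrow> S (R x) = x"
    using assms unfolding invertible_on_def by blast
  have "R x \<in> M" if "x \<in> M" for x using R(1) that by (auto simp: bounded_op_on_def invariant_under_def)
  then show ?thesis using R(2,3) mem by (intro bij_betw_byWitness[where f' = R]) auto
qed

text \<open>
  Applying \<open>S\<close> to \<open>M = S\<^sup>n M + G\<close> and adding a complement \<open>F\<close> of \<open>S M\<close> gives
  \<open>M = S\<^sup>n\<^sup>+\<^sup>1 M + (S G + F)\<close>.
\<close>

lemma finite_codim_range_power:
  assumes "finite_codim_in M (S ` M)"
  shows "finite_codim_in M ((S ^^ n) ` M)"
proof (induction n)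
  case 0
  have "cfinite_dim {0}"
    unfolding cfinite_dim_def by (intro exI[of _ "{}"]) (simp add: complex_vector.span_empty)
  then show ?case
    using finite_codim_inI[OF csubspace, of "{0}" M] by simp
next
  case (Suc n)
  obtain F where F: "csubspace F" "cfinite_dim F" "direct_sum (S ` M) F M"
    using assms unfolding finite_codim_in_def fin_complement_in_def by blast
  obtain G where G: "csubspace G" "cfinite_dim G" "direct_sum ((S ^^ n) ` M) G M"
    using Suc unfolding finite_codim_in_def fin_complement_in_def by blast
  have sR: "csubspace (S ` M)" by (rule csubspace_image[OF clinear csubspace])
  note dF = direct_sumD[OF sR F(1,3)]
  note dG = direct_sumD[OF csubspace_range G(1,3)]
  define H where "H = {x + y | x y. x \<in> S ` G \<and> y \<in> F}"
  have H: "csubspace H" "cfinite_dim H"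
    unfolding H_def
    by (intro complex_vector.subspace_sums csubspace_image[OF clinear] G F)
      (intro cfinite_dim_sum cfinite_dim_image[OF clinear] G F)
  have HM: "H \<subseteq> M" unfolding H_def using dG(5) mem dF(2) by blast
  have "M = {x + y | x y. x \<in> (S ^^ Suc n) ` M \<and> y \<in> H}"
  proof
    show "M \<subseteq> {x + y | x y. x \<in> (S ^^ Suc n) ` M \<and> y \<in> H}"
    proof
      fix m assume "m \<in> M"
      then obtain u f where uf: "u \<in> M" "f \<in> F" "m = S u + f" using dF(3) by blast
      then obtain v g where vg: "v \<in> M" "g \<in> G" "u = (S ^^ n) v + g" using dG(3) by blast
      have "m = (S ^^ Suc n) v + (S g + f)" using uf vg by (simp add: lin add.assoc)
      moreover have "S g + f \<in> H" unfolding H_def using uf vg by blast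
      ultimately show "m \<in> {x + y | x y. x \<in> (S ^^ Suc n) ` M \<and> y \<in> H}" using vg(1) by blast
    qed
    show "{x + y | x y. x \<in> (S ^^ Suc n) ` M \<and> y \<in> H} \<subseteq> M"
      using range_subset[of "Suc n"] HM complex_vector.subspace_add[OF csubspace] by blast
  qed
  then show ?case by (rule finite_codim_inI[OF csubspace_range H])
qed

text \<open>
  \<open>S\<close> maps \<open>ker S\<^sup>n\<^sup>+\<^sup>1\<close> into \<open>ker S\<^sup>n\<close> with a kernel inside \<open>ker S\<close>.
\<close>

lemma cfinite_dim_kernel_power:
  assumes "cfinite_dim (kernel_on M S)"
  shows "cfinite_dim (kernel_on M (S ^^ n))"
proof (induction n)
  case 0
  have "kernel_on M (S ^^ 0) \<subseteq> cspan {}" by (auto simp: kernel_on_def complex_vector.span_empty)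
  then show ?case unfolding cfinite_dim_def by blast
next
  case (Suc n)
  let ?V = "kernel_on M (S ^^ Suc n)"
  have "kernel_on ?V S \<subseteq> kernel_on M S" "S ` ?V \<subseteq> kernel_on M (S ^^ n)"
    using mem by (auto simp: kernel_on_def funpow_swap1)
  then show ?case
    using cfinite_dim_subset assms Suc
    by (intro cfinite_dim_of_kernel_and_image[OF clinear operator_on_closed_subspace.csubspace_kernel[OF power]]) blast+
qed

text \<open>
  The hypothesis on the intersections expresses infinite ascent. The chain lives in the
  intersection \<open>I\<close> of all ranges. That \<open>S\<close> maps \<open>I\<close> onto itself rests on the stabilisation of
  \<open>ker S \<inter> S\<^sup>n M\<close> at some \<open>d\<close>: a preimage \<open>u\<close> of \<open>y \<in> I\<close> chosen in \<open>S\<^sup>d M\<close> differs from a preimage in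
  \<open>S\<^sup>n M\<close> by an element of \<open>ker S \<inter> S\<^sup>d M = ker S \<inter> S\<^sup>n M\<close>, so \<open>u\<close> itself lies in \<open>S\<^sup>n M\<close>.
\<close>

lemma bounded_chain_of_infinite_ascent:
  assumes fredholm: "fredholm_on M S" and inf: "\<And>n. kernel_on M S \<inter> (S ^^ n) ` M \<noteq> {0}"
  obtains x C where "C > 0" "x 0 \<noteq> 0" "S (x 0) = 0" "\<And>n. S (x (Suc n)) = x n"
    "\<And>n. norm (x n) \<le> norm (x 0) * C ^ n"
proof -
  have finK: "cfinite_dim (kernel_on M S)" and codim: "finite_codim_in M (S ` M)"
    using fredholm by (auto simp: fredholm_on_def)
  define L where "L n = kernel_on M S \<inter> (S ^^ n) ` M" for n
  have sL: "csubspace (L n)" for n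
    unfolding L_def by (intro complex_vector.subspace_inter csubspace_kernel csubspace_range)
  have decL: "L (Suc n) \<subseteq> L n" for n unfolding L_def using range_Suc_subset by blast
  have "cfinite_dim (L 0)" using cfinite_dim_subset[OF finK] by (simp add: L_def)
  then obtain d where d: "\<And>n. d \<le> n \<Longrightarrow> L n = L d"
    using decreasing_csubspaces_stabilise[of L] sL decL by blast
  \<comment> \<open>the hyperrange: the part of \<open>M\<close> that can be lifted through every power of \<open>S\<close>\<close>
  define I where "I = (\<Inter>n. (S ^^ n) ` M)"
  have range_anti: "(S ^^ n) ` M \<subseteq> (S ^^ m) ` M" if "m \<le> n" for m n
    by (rule lift_Suc_antimono_le[of "\<lambda>n. (S ^^ n) ` M", OF range_Suc_subset that])
  have I_late: "x \<in> I" if "\<And>n. d \<le> n \<Longrightarrow> x \<in> (S ^^ n) ` M" for x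
    unfolding I_def
  proof
    fix n
    have "x \<in> (S ^^ max d n) ` M" by (rule that) simp
    then show "x \<in> (S ^^ n) ` M" using range_anti[of n "max d n"] by auto
  qed
  have sI: "csubspace I" unfolding I_def by (intro complex_vector.subspace_Int csubspace_range)
  have clI: "closed I" unfolding I_def
    by (intro closed_INT ballI operator_on_closed_subspace.closed_range_of_finite_codim[OF power]
        finite_codim_range_power codim)
  have "S ` I = I"
  proof
    show "S ` I \<subseteq> I"
    proof clarify
      fix x assume x: "x \<in> I"
      show "S x \<in> I" unfolding I_def
      proof
        fix n
        obtain u where "u \<in> M" "x = (S ^^ n) u" using x unfolding I_def by blast
        then have "S x \<in> (S ^^ Suc n) ` M" by simp
        then show "S x \<in> (S ^^ n) ` M" using range_Suc_subset by blast
      qed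
    qed
    show "I \<subseteq> S ` I"
    proof
      fix y assume y: "y \<in> I"
      have ex: "\<exists>u\<in>(S ^^ n) ` M. y = S u" for n
      proof -
        have "y \<in> (S ^^ Suc n) ` M" using y unfolding I_def by blast
        then show ?thesis by auto
      qed
      then obtain u where u: "u \<in> (S ^^ d) ` M" "y = S u" by blast
      have "u \<in> I"
      proof (rule I_late)
        fix n assume n: "d \<le> n"
        obtain v where v: "v \<in> (S ^^ n) ` M" "y = S v" using ex by blast
        have "v \<in> (S ^^ d) ` M" using v(1) range_anti[OF n] by blast
        then have "u - v \<in> (S ^^ d) ` M" using u(1) complex_vector.subspace_diff[OF csubspace_range] by blast
        then have "u - v \<in> L d" using u(2) v(2) range_subset[of d] by (auto simp: L_def kernel_on_def lin)
        then have "u - v \<in> (S ^^ n) ` M" using d[OF n] by (auto simp: L_def)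
        then have "(u - v) + v \<in> (S ^^ n) ` M" using v(1) complex_vector.subspace_add[OF csubspace_range] by blast
        then show "u \<in> (S ^^ n) ` M" by simp
      qed
      then show "y \<in> S ` I" using u(2) by blast
    qed
  qed
  then obtain C where C: "C > 0" "\<And>y. y \<in> I \<Longrightarrow> \<exists>x\<in>I. S x = y \<and> norm x \<le> C * norm y"
    using open_mapping_on_closed_subspace[OF bounded_linear csubspace_imp_subspace[OF sI] clI clI] by metis
  then obtain g where g: "\<And>y. y \<in> I \<Longrightarrow> g y \<in> I \<and> S (g y) = y \<and> norm (g y) \<le> C * norm y" by metis
  have "0 \<in> L d" by (rule complex_vector.subspace_0[OF sL])
  then obtain x0 where x0: "x0 \<in> L d" "x0 \<noteq> 0" using inf[of d] unfolding L_def by blast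
  have x0I: "x0 \<in> I" by (rule I_late) (use x0(1) d in \<open>auto simp: L_def\<close>)
  define x where "x n = (g ^^ n) x0" for n
  have xI: "x n \<in> I" for n unfolding x_def by (induction n) (simp_all add: x0I g)
  show thesis
  proof
    show "C > 0" by (rule C(1))
    show "x 0 \<noteq> 0" "S (x 0) = 0" using x0 by (auto simp: x_def L_def kernel_on_def)
    show "S (x (Suc n)) = x n" for n using g[OF xI[of n]] by (simp add: x_def)
    show "norm (x n) \<le> norm (x 0) * C ^ n" for n
    proof (induction n)
      case (Suc n)
      have "norm (x (Suc n)) \<le> C * norm (x n)" using g[OF xI[of n]] by (simp add: x_def)
      also have "\<dots> \<le> C * (norm (x 0) * C ^ n)" using Suc C(1) by (intro mult_left_mono) auto
      finally show ?case by (simp add: mult_ac)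
    qed simp
  qed
qed

text \<open>
  The key point is \<open>M = S M + Q\<close> for \<open>Q = ker S\<^sup>p\<close>. As the kernels of the powers no longer grow,
  \<open>S M \<inter> Q = S Q\<close>. So a complement \<open>G\<close> of \<open>S Q\<close> in \<open>Q\<close> meets \<open>S M\<close> only in \<open>0\<close>, and its dimension is
  \<open>dim ker S\<close> by rank-nullity. Index zero says that this is the codimension of \<open>S M\<close>, hence
  \<open>M = S M \<oplus> G\<close>. Iterating \<open>M = S M + Q\<close> gives \<open>M = S\<^sup>p M + Q\<close> and the surjectivity on \<open>S\<^sup>p M\<close>.
\<close>

theorem weyl_with_finite_ascent:
  assumes weyl: "weyl_on M S" and asc: "kernel_on M S \<inter> (S ^^ p) ` M = {0}"
  shows "direct_sum ((S ^^ p) ` M) (kernel_on M (S ^^ p)) M"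
    and "bij_betw S ((S ^^ p) ` M) ((S ^^ p) ` M)"
proof -
  let ?R = "(S ^^ p) ` M" and ?Q = "kernel_on M (S ^^ p)"
  have fred: "cfinite_dim (kernel_on M S)" "finite_codim_in M (S ` M)"
    and idx: "cdim (kernel_on M S) = codim_in M (S ` M)"
    using weyl by (auto simp: weyl_on_def fredholm_on_def index_on_def)
  have sR1: "csubspace (S ` M)" by (rule csubspace_image[OF clinear csubspace])
  obtain F where F: "fin_complement_in M (S ` M) F" using fred(2) unfolding finite_codim_in_def by blast
  have dimF: "cdim F = cdim (kernel_on M S)" using codim_in_eq[OF sR1 F] idx by simp
  have sQ: "csubspace ?Q" by (rule operator_on_closed_subspace.csubspace_kernel[OF power])
  have fQ: "cfinite_dim ?Q" by (rule cfinite_dim_kernel_power[OF fred(1)])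
  have SQ: "S ` ?Q \<subseteq> ?Q" using mem by (auto simp: kernel_on_def lin funpow_swap1[symmetric])
  have kerQ: "kernel_on ?Q S = kernel_on M S"
  proof
    show "kernel_on M S \<subseteq> kernel_on ?Q S"
    proof
      fix x assume x: "x \<in> kernel_on M S"
      show "x \<in> kernel_on ?Q S"
      proof (cases p)
        case 0
        then have "x \<in> {0}" using asc x by (auto simp: kernel_on_def)
        then show ?thesis using complex_vector.subspace_0[OF csubspace] by (auto simp: kernel_on_def power_lin lin)
      next
        case (Suc k)
        then show ?thesis using x by (auto simp: kernel_on_def funpow_swap1 power_lin)
      qed
    qed
  qed (auto simp: kernel_on_def)
  have RQ: "S ` M \<inter> ?Q \<subseteq> S ` ?Q"
  proof clarify
    fix x assume x: "x \<in> M" "S x \<in> ?Q"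
    have "(S ^^ p) x \<in> kernel_on M S \<inter> ?R"
      using x power_mem by (auto simp: kernel_on_def funpow_swap1)
    then have "x \<in> ?Q" using asc x(1) by (auto simp: kernel_on_def)
    then show "S x \<in> S ` ?Q" by blast
  qed
  obtain G where G: "fin_complement_in ?Q (S ` ?Q) G" "cdim G = cdim (kernel_on M S)"
    using rank_nullity_complement[OF clinear sQ fQ SQ] kerQ by metis
  have sG: "csubspace G" and fG: "cfinite_dim G" and dG: "direct_sum (S ` ?Q) G ?Q"
    using G(1) by (auto simp: fin_complement_in_def)
  note dG' = direct_sumD[OF csubspace_image[OF clinear sQ] sG dG]
  have "S ` M \<inter> G = {0}"
    by (rule trivial_Int_subspaces[OF sR1 sG]) (use dG'(1,5) RQ in blast)
  moreover have "G \<subseteq> M" using dG'(5) by (auto simp: kernel_on_def)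
  ultimately have MG: "M = {x + y | x y. x \<in> S ` M \<and> y \<in> G}"
    using complement_of_full_dimension[OF sR1 F csubspace sG fG] dimF G(2) by simp
  have step: "\<exists>u\<in>M. \<exists>q\<in>?Q. m = S u + q" if "m \<in> M" for m
    using that dG'(5) by (subst (asm) MG) blast
  have inj: "x = 0" if "x \<in> ?R" "S x = 0" for x
    using that asc range_subset[of p] by (auto simp: kernel_on_def)
  have SR: "S x \<in> ?R" if "x \<in> ?R" for x
    using that mem by (auto simp: funpow_swap1)
  have sum: "\<exists>u\<in>M. \<exists>q\<in>?Q. m = (S ^^ n) u + q" if "m \<in> M" for m n
    using that
  proof (induction n arbitrary: m)
    case 0
    then show ?case using complex_vector.subspace_0[OF sQ] by force
  next
    case (Suc n)
    obtain u q where uq: "u \<in> M" "q \<in> ?Q" "m = S u + q" using step[OF Suc.prems] by blast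
    obtain v r where vr: "v \<in> M" "r \<in> ?Q" "u = (S ^^ n) v + r" using Suc.IH[OF uq(1)] by blast
    have "m = (S ^^ Suc n) v + (S r + q)" using uq vr by (simp add: lin add.assoc)
    moreover have "S r + q \<in> ?Q" using SQ vr(2) uq(2) complex_vector.subspace_add[OF sQ] by blast
    ultimately show ?case using vr(1) by blast
  qed
  have power_inj: "x = 0" if "x \<in> ?R" "(S ^^ n) x = 0" for x n
    using that
  proof (induction n arbitrary: x)
    case (Suc n)
    then have "S x = 0" using SR by (simp add: funpow_swap1)
    then show ?case using inj Suc.prems by blast
  qed simp
  show "direct_sum ?R ?Q M"
  proof (rule direct_sumI)
    show "?R \<inter> ?Q = {0}"
      by (rule trivial_Int_subspaces[OF csubspace_range sQ]) (auto simp: kernel_on_def intro: power_inj)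
    have QM: "?Q \<subseteq> M" by (auto simp: kernel_on_def)
    show "x + y \<in> M" if "x \<in> ?R" "y \<in> ?Q" for x y
      using that range_subset[of p] QM complex_vector.subspace_add[OF csubspace] by blast
    show "\<exists>x\<in>?R. \<exists>y\<in>?Q. m = x + y" if "m \<in> M" for m using sum[OF that, of p] by blast
  qed
  show "bij_betw S ?R ?R"
    unfolding bij_betw_def
  proof
    show "inj_on S ?R"
    proof (rule inj_onI)
      fix x y assume "x \<in> ?R" "y \<in> ?R" "S x = S y"
      then show "x = y" using inj[of "x - y"] complex_vector.subspace_diff[OF csubspace_range] lin(2) by auto
    qed
    show "S ` ?R = ?R"
    proof
      show "?R \<subseteq> S ` ?R"
      proof clarify
        fix m assume "m \<in> M"
        then obtain u q where "u \<in> M" "q \<in> ?Q" "m = S u + q" using step by blast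
        then have "(S ^^ p) m = S ((S ^^ p) u)" by (auto simp: power_lin kernel_on_def funpow_swap1)
        then show "(S ^^ p) m \<in> S ` ?R" using \<open>u \<in> M\<close> by blast
      qed
    qed (use SR in blast)
  qed
qed

text \<open>
  This is the quasi-nilpotence of a nilpotent operator. Surjectivity goes by induction on the order of
  nilpotency: \<open>S x\<close> has smaller order than \<open>x\<close>, and a solution for \<open>S x\<close> yields one for \<open>x\<close>.
\<close>

lemma shift_bij_on_power_kernel:
  assumes z: "z \<noteq> 0"
  shows "bij_betw (\<lambda>x. S x - z *\<^sub>C x) (kernel_on M (S ^^ p)) (kernel_on M (S ^^ p))"
proof -
  let ?K = "\<lambda>n. kernel_on M (S ^^ n)"
  have sK: "csubspace (?K n)" for n by (rule operator_on_closed_subspace.csubspace_kernel[OF power])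
  have SK: "S x \<in> ?K n" if "x \<in> ?K n" for x n
    using that mem by (auto simp: kernel_on_def funpow_swap1[symmetric] lin)
  have zero: "x = 0" if "S x = z *\<^sub>C x" "(S ^^ n) x = 0" for x n
    using that(2)
  proof (induction n)
    case (Suc n)
    have "(S ^^ Suc n) x = z *\<^sub>C (S ^^ n) x" using that(1) by (simp add: funpow_swap1 power_lin)
    then show ?case using Suc z by (simp add: complex_vector.scale_eq_0_iff)
  qed simp
  have onto: "\<exists>y\<in>?K n. S y - z *\<^sub>C y = x" if "x \<in> ?K n" for x n
    using that
  proof (induction n arbitrary: x)
    case 0
    then show ?case by (auto simp: kernel_on_def lin)
  next
    case (Suc n)
    have "S x \<in> ?K n" using Suc.prems mem by (auto simp: kernel_on_def funpow_swap1)
    then obtain y where y: "y \<in> ?K n" "S y - z *\<^sub>C y = S x" using Suc.IH by blast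
    \<comment> \<open>\<open>u\<close> solves \<open>S u - z u = x\<close> because \<open>z u = y - x\<close> and \<open>S (z u) = S y - S x = z y\<close>.\<close>
    define u where "u = inverse z *\<^sub>C (y - x)"
    have "y \<in> ?K (Suc n)" using y(1) by (auto simp: kernel_on_def lin)
    then have "u \<in> ?K (Suc n)" unfolding u_def
      using Suc.prems by (intro complex_vector.subspace_scale[OF sK] complex_vector.subspace_diff[OF sK])
    moreover have "S u - z *\<^sub>C u = x"
    proof -
      have "S u = inverse z *\<^sub>C (S y - S x)" by (simp add: u_def lin)
      also have "S y - S x = z *\<^sub>C y" using y(2) by (simp add: algebra_simps)
      finally show ?thesis using z by (simp add: u_def scaleC_scaleC scaleC_one)
    qed
    ultimately show ?case by blast
  qed
  show ?thesis
    unfolding bij_betw_def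
  proof
    show "inj_on (\<lambda>x. S x - z *\<^sub>C x) (?K p)"
    proof (rule inj_onI)
      fix x y assume xy: "x \<in> ?K p" "y \<in> ?K p" "S x - z *\<^sub>C x = S y - z *\<^sub>C y"
      then have "S (x - y) = z *\<^sub>C (x - y)"
        by (simp add: lin complex_vector.scale_right_diff_distrib algebra_simps)
      moreover have "(S ^^ p) (x - y) = 0" using xy by (simp add: kernel_on_def power_lin)
      ultimately show "x = y" using zero by force
    qed
    show "(\<lambda>x. S x - z *\<^sub>C x) ` ?K p = ?K p"
      using onto SK complex_vector.subspace_diff[OF sK] complex_vector.subspace_scale[OF sK] by blast
  qed
qed

end

lemma cblinfun_apply_is_linear:
  fixes A :: "'a::complex_banach \<Rightarrow>\<^sub>\<complex> 'b::complex_banach"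
  shows bounded_linear_cblinfun_apply: "bounded_linear (cblinfun_apply A)"
    and clinear_cblinfun_apply: "clinear (cblinfun_apply A)"
proof -
  show "clinear (cblinfun_apply A)"
    by (rule clinearI) (simp_all add: cblinfun_apply_add cblinfun_apply_scaleC)
  show "bounded_linear (cblinfun_apply A)"
    unfolding cblinfun_apply.rep_eq by (rule blinfun.bounded_linear_right)
qed

lemma operator_on_closed_subspace_cblinfun:
  "closed_csubspace M \<Longrightarrow> invariant_under (cblinfun_apply A) M
    \<Longrightarrow> operator_on_closed_subspace (cblinfun_apply A) M"
  by (intro operator_on_closed_subspace.intro bounded_linear_cblinfun_apply clinear_cblinfun_apply)

section \<open>From the SVEP to generalized Drazin invertibility\<close>

text \<open>
  Since \<open>S\<close> shifts the coefficients, \<open>f w = \<Sum>n. (w - z) ^ n *\<^sub>C x n\<close> satisfies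
  \<open>S (f w) = (w - z) *\<^sub>C f w\<close> for \<open>S = T - z I\<close>, that is, \<open>f w\<close> lies in the kernel of \<open>T - w I\<close>.
\<close>

lemma SVEP_at_excludes_bounded_chain:
  fixes T :: "'a::complex_banach \<Rightarrow>\<^sub>\<complex> 'a"
  assumes svep: "SVEP_at T z" and C: "C > 0"
    and x: "cblinfun_apply (T - z *\<^sub>C id_cblinfun) (x 0) = 0"
      "\<And>n. cblinfun_apply (T - z *\<^sub>C id_cblinfun) (x (Suc n)) = x n"
      "\<And>n. norm (x n) \<le> D * C ^ n"
  shows "x 0 = 0"
proof -
  let ?S = "cblinfun_apply (T - z *\<^sub>C id_cblinfun)"
  define f where "f w = (\<Sum>n. (w - z) ^ n *\<^sub>C x n)" for w
  have "vector_analytic_on f (ball z (1 / C))"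
    unfolding f_def[abs_def] by (rule vector_powser_analytic_on_ball[OF C x(3)])
  moreover have "cblinfun_apply (T - w *\<^sub>C id_cblinfun) (f w) = 0" if w: "w \<in> ball z (1 / C)" for w
  proof -
    have q: "cmod (w - z) * C < 1" using w C by (simp add: dist_norm norm_minus_commute field_simps)
    have "summable (\<lambda>n. norm ((w - z) ^ n *\<^sub>C x n))"
    proof (rule summable_comparison_test')
      show "summable (\<lambda>n. D * (cmod (w - z) * C) ^ n)"
        using q C by (intro summable_mult summable_geometric) simp
      show "norm (norm ((w - z) ^ n *\<^sub>C x n)) \<le> D * (cmod (w - z) * C) ^ n" for n
        using mult_left_mono[OF x(3)[of n], of "cmod (w - z) ^ n"]
        by (simp add: norm_scaleC norm_power power_mult_distrib mult_ac)
    qed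
    then have sums: "(\<lambda>n. (w - z) ^ n *\<^sub>C x n) sums f w"
      unfolding f_def by (rule summable_sums[OF summable_norm_cancel])
    have "(\<lambda>n. (w - z) *\<^sub>C (w - z) ^ n *\<^sub>C x n) sums ((w - z) *\<^sub>C f w)"
      by (rule bounded_linear.sums[OF bounded_bilinear.bounded_linear_right[OF bounded_bilinear_scaleC] sums])
    moreover have "?S ((w - z) ^ Suc n *\<^sub>C x (Suc n)) = (w - z) *\<^sub>C (w - z) ^ n *\<^sub>C x n" for n
      by (simp only: cblinfun_apply_scaleC x(2) scaleC_scaleC power_Suc)
    ultimately have "(\<lambda>n. ?S ((w - z) ^ Suc n *\<^sub>C x (Suc n))) sums ((w - z) *\<^sub>C f w)"
      by (simp only:)
    then have "(\<lambda>n. ?S ((w - z) ^ n *\<^sub>C x n)) sums ((w - z) *\<^sub>C f w + ?S ((w - z) ^ 0 *\<^sub>C x 0))"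
      by (rule sums_Suc)
    then have "(\<lambda>n. ?S ((w - z) ^ n *\<^sub>C x n)) sums ((w - z) *\<^sub>C f w)"
      by (simp only: power_0 scaleC_one x(1) add_0_right)
    moreover have "(\<lambda>n. ?S ((w - z) ^ n *\<^sub>C x n)) sums ?S (f w)"
      by (rule bounded_linear.sums[OF bounded_linear_cblinfun_apply sums])
    ultimately have "?S (f w) = (w - z) *\<^sub>C f w" by (rule sums_unique2[rotated])
    then show ?thesis
      by (simp add: cblinfun_apply_minus_scaleC_id complex_vector.scale_left_diff_distrib)
  qed
  ultimately have "f z = 0"
    using svep C unfolding SVEP_at_def
    by (metis centre_in_ball connected_ball open_ball zero_less_divide_1_iff)
  moreover have "f z = x 0"
  proof -
    have "(\<lambda>n. (z - z) ^ n *\<^sub>C x n) sums (\<Sum>n\<in>{0}. (z - z) ^ n *\<^sub>C x n)"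
      by (rule sums_finite) (auto simp: power_0_left)
    then show ?thesis unfolding f_def by (simp add: scaleC_one sums_iff)
  qed
  ultimately show ?thesis by simp
qed

text \<open>
  By the open mapping theorem the spectrum is detected by bijectivity alone, which is easy to
  combine over direct sums.
\<close>

lemma quasinilpotent_on_iff_bij:
  assumes "operator_on_closed_subspace S M"
  shows "quasinilpotent_on M S \<longleftrightarrow> (\<forall>z. z \<noteq> 0 \<longrightarrow> bij_betw (\<lambda>x. S x - z *\<^sub>C x) M M)"
proof -
  have "invertible_on M (\<lambda>x. S x - z *\<^sub>C x) \<longleftrightarrow> bij_betw (\<lambda>x. S x - z *\<^sub>C x) M M" for z
    using operator_on_closed_subspace.shift[OF assms]
    by (blast intro: operator_on_closed_subspace.bij_if_invertible_on
        operator_on_closed_subspace.invertible_on_if_bij)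
  then show ?thesis unfolding quasinilpotent_on_def spectrum_on_def by blast
qed

theorem generalized_Drazin_if_pseudo_B_Weyl_and_SVEP:
  fixes T :: "'a::complex_banach \<Rightarrow>\<^sub>\<complex> 'a"
  assumes pBW: "pseudo_B_Weyl (T - z *\<^sub>C id_cblinfun)" and svep: "SVEP_at T z"
  shows "generalized_Drazin_invertible (T - z *\<^sub>C id_cblinfun)"
proof -
  let ?S = "cblinfun_apply (T - z *\<^sub>C id_cblinfun)"
  obtain M N where M: "closed_csubspace M" "invariant_under ?S M" "weyl_on M ?S"
    and N: "closed_csubspace N" "invariant_under ?S N" "quasinilpotent_on N ?S"
    and MN: "direct_sum M N UNIV"
    using pBW unfolding pseudo_B_Weyl_def by blast
  interpret M: operator_on_closed_subspace ?S M by (rule operator_on_closed_subspace_cblinfun[OF M(1,2)])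
  interpret N: operator_on_closed_subspace ?S N by (rule operator_on_closed_subspace_cblinfun[OF N(1,2)])
  have "\<exists>p. kernel_on M ?S \<inter> (?S ^^ p) ` M = {0}"
  proof (rule ccontr)
    assume "\<not> ?thesis"
    then have inf: "kernel_on M ?S \<inter> (?S ^^ p) ` M \<noteq> {0}" for p by blast
    have "fredholm_on M ?S" using M(3) by (simp add: weyl_on_def)
    then show False
    proof (rule M.bounded_chain_of_infinite_ascent[OF _ inf])
      fix x C
      assume "C > 0" "x 0 \<noteq> 0" and chain: "?S (x 0) = 0" "\<And>n. ?S (x (Suc n)) = x n"
        "\<And>n. norm (x n) \<le> norm (x 0) * C ^ n"
      then show False using SVEP_at_excludes_bounded_chain[OF svep \<open>C > 0\<close> chain] by blast
    qed
  qed
  then obtain p where p: "kernel_on M ?S \<inter> (?S ^^ p) ` M = {0}" by blast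
  define R where "R = (?S ^^ p) ` M"
  define K where "K = kernel_on M (?S ^^ p)"
  define Q where "Q = {x + y | x y. x \<in> K \<and> y \<in> N}"
  have sR: "csubspace R" unfolding R_def by (rule M.csubspace_range)
  have sK: "csubspace K" unfolding K_def by (rule operator_on_closed_subspace.csubspace_kernel[OF M.power])
  have sQ: "csubspace Q" unfolding Q_def by (rule complex_vector.subspace_sums[OF sK N.csubspace])
  note RK = direct_sumD[OF sR sK M.weyl_with_finite_ascent(1)[OF M(3) p, folded R_def K_def]]
  note MN' = direct_sumD[OF M.csubspace N.csubspace MN]
  have bR: "bij_betw ?S R R" unfolding R_def by (rule M.weyl_with_finite_ascent(2)[OF M(3) p])
  have clR: "closed R" unfolding R_def
    using M(3) by (intro operator_on_closed_subspace.closed_range_of_finite_codim[OF M.power]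
        M.finite_codim_range_power) (simp add: weyl_on_def fredholm_on_def)
  have clK: "closed K" unfolding K_def by (rule operator_on_closed_subspace.closed_kernel[OF M.power])
  have clQ: "closed Q" unfolding Q_def by (rule closed_sum_of_closed_summand[OF M(1) N(1) MN clK RK(5)])
  have R: "operator_on_closed_subspace ?S R"
    using sR clR bR by (intro operator_on_closed_subspace_cblinfun)
      (auto simp: closed_csubspace_def invariant_under_def bij_betw_def)
  have "?S x \<in> K" if "x \<in> K" for x
    using that M.mem by (auto simp: K_def kernel_on_def funpow_swap1[symmetric] M.lin)
  then have "invariant_under ?S Q"
    using N.mem by (fastforce simp: Q_def invariant_under_def M.lin)
  then have Q: "operator_on_closed_subspace ?S Q"
    using sQ clQ by (intro operator_on_closed_subspace_cblinfun) (auto simp: closed_csubspace_def)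
  have KN: "K \<inter> N = {0}"
    using MN'(1) RK(5) by (intro trivial_Int_subspaces[OF sK N.csubspace]) blast
  have "quasinilpotent_on Q ?S"
    unfolding quasinilpotent_on_iff_bij[OF Q]
  proof (intro allI impI)
    fix w :: complex assume w: "w \<noteq> 0"
    show "bij_betw (\<lambda>x. ?S x - w *\<^sub>C x) Q Q"
      unfolding Q_def
    proof (rule bij_betw_sum_of_subspaces[OF _ sK N.csubspace KN])
      show "clinear (\<lambda>x. ?S x - w *\<^sub>C x)" by (rule operator_on_closed_subspace.clinear[OF M.shift])
      show "bij_betw (\<lambda>x. ?S x - w *\<^sub>C x) K K" unfolding K_def by (rule M.shift_bij_on_power_kernel[OF w])
      show "bij_betw (\<lambda>x. ?S x - w *\<^sub>C x) N N"
        using N(3) w quasinilpotent_on_iff_bij[OF N.operator_on_closed_subspace_axioms] by blast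
    qed
  qed
  moreover have "invertible_on R ?S" by (rule operator_on_closed_subspace.invertible_on_if_bij[OF R bR])
  moreover have "direct_sum R Q UNIV"
  proof (rule direct_sumI)
    show "R \<inter> Q = {0}"
    proof (rule trivial_Int_subspaces[OF sR sQ])
      fix r assume r: "r \<in> R" "r \<in> Q"
      then obtain a b where ab: "a \<in> K" "b \<in> N" "r = a + b" unfolding Q_def by blast
      have "r = a \<and> 0 = b"
        by (rule direct_sum_unique[OF M.csubspace N.csubspace MN'(1)])
          (use r ab RK(4,5) complex_vector.subspace_0[OF N.csubspace] in auto)
      then show "r = 0" using RK(1) r(1) ab(1) by blast
    qed
    show "\<exists>x\<in>R. \<exists>y\<in>Q. m = x + y" for m
    proof -
      obtain u v where uv: "u \<in> M" "v \<in> N" "m = u + v" using MN'(3)[of m] by auto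
      obtain r k where rk: "r \<in> R" "k \<in> K" "u = r + k" using RK(3)[OF uv(1)] by blast
      have "m = r + (k + v)" using uv(3) rk(3) by (simp add: add.assoc)
      moreover have "k + v \<in> Q" unfolding Q_def using rk(2) uv(2) by blast
      ultimately show ?thesis using rk(1) by blast
    qed
  qed simp
  ultimately show ?thesis
    unfolding generalized_Drazin_invertible_def
    using R Q unfolding operator_on_closed_subspace_def by blast
qed

theorem pseudo_B_Weyl_if_generalized_Drazin:
  fixes T :: "'a::complex_banach \<Rightarrow>\<^sub>\<complex> 'a"
  assumes "generalized_Drazin_invertible T"
  shows "pseudo_B_Weyl T"
proof -
  obtain M N where MN: "closed_csubspace M" "closed_csubspace N" "invariant_under T M" "invariant_under T N"
      "direct_sum M N UNIV" "invertible_on M T" "quasinilpotent_on N T"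
    using assms unfolding generalized_Drazin_invertible_def by blast
  interpret M: operator_on_closed_subspace "cblinfun_apply T" M
    by (rule operator_on_closed_subspace_cblinfun[OF MN(1,3)])
  have bij: "bij_betw T M M" by (rule M.bij_if_invertible_on[OF MN(6)])
  then have img: "T ` M = M" by (simp add: bij_betw_def)
  have ker: "kernel_on M T = {0}"
  proof -
    have "x = 0" if "x \<in> M" "T x = 0" for x
      using that bij M.lin(4) complex_vector.subspace_0[OF M.csubspace] unfolding bij_betw_def
      by (metis inj_onD)
    then show ?thesis using M.lin(4) complex_vector.subspace_0[OF M.csubspace] by (auto simp: kernel_on_def)
  qed
  have fin0: "cfinite_dim {0 :: 'a}"
    unfolding cfinite_dim_def by (intro exI[of _ "{}"]) (simp add: complex_vector.span_empty)
  have compl: "fin_complement_in M M {0}"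
    unfolding fin_complement_in_def direct_sum_def
    using fin0 complex_vector.subspace_0[OF M.csubspace] by (auto simp: complex_vector.subspace_single_0)
  have "weyl_on M T"
    unfolding weyl_on_def fredholm_on_def index_on_def img ker finite_codim_in_def
    using codim_in_eq[OF M.csubspace compl] compl fin0 by auto
  then show ?thesis unfolding pseudo_B_Weyl_def using MN by blast
qed

section \<open>From generalized Drazin invertibility to the SVEP\<close>

text \<open>
  If \<open>R\<close> inverts \<open>S\<close> on \<open>M\<close> and has norm at most \<open>K\<close> there, then \<open>e = 1 / K\<close> works. On \<open>N\<close> both claims
  hold because \<open>S - w I\<close> is bijective. An eigenvector \<open>a\<close> in \<open>M\<close> satisfies \<open>a = w R a\<close>, and a
  functional that vanishes on the range of \<open>S - w I\<close> satisfies \<open>\<phi> = w \<phi> R\<close> on \<open>M\<close>; both are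
  impossible for nonzero \<open>a\<close> and \<open>\<phi>\<close> since \<open>w R\<close> is a contraction.
\<close>

lemma generalized_Drazin_punctured_disc:
  fixes S :: "'a::complex_banach \<Rightarrow>\<^sub>\<complex> 'a"
  assumes "generalized_Drazin_invertible S"
  obtains e where "e > 0"
    and "\<And>w x. w \<noteq> 0 \<Longrightarrow> cmod w < e \<Longrightarrow> S x = w *\<^sub>C x \<Longrightarrow> x = 0"
    and "\<And>w \<phi>. w \<noteq> 0 \<Longrightarrow> cmod w < e \<Longrightarrow> (\<And>x. cblinfun_apply \<phi> (S x) = w * cblinfun_apply \<phi> x)
      \<Longrightarrow> \<phi> = (0 :: 'a cdual)"
proof -
  obtain M N where M: "closed_csubspace M" "invariant_under S M" "invertible_on M S"
    and N: "closed_csubspace N" "invariant_under S N" "quasinilpotent_on N S"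
    and MN: "direct_sum M N UNIV"
    using assms unfolding generalized_Drazin_invertible_def by blast
  interpret M: operator_on_closed_subspace "cblinfun_apply S" M
    by (rule operator_on_closed_subspace_cblinfun[OF M(1,2)])
  interpret N: operator_on_closed_subspace "cblinfun_apply S" N
    by (rule operator_on_closed_subspace_cblinfun[OF N(1,2)])
  note MN' = direct_sumD[OF M.csubspace N.csubspace MN]
  obtain R where R: "bounded_op_on M R" "\<And>x. x \<in> M \<Longrightarrow> R (S x) = x" "\<And>x. x \<in> M \<Longrightarrow> S (R x) = x"
    using M(3) unfolding invertible_on_def by blast
  have RM: "R x \<in> M" if "x \<in> M" for x using R(1) that by (auto simp: bounded_op_on_def invariant_under_def)
  obtain K0 where K0: "\<And>x. x \<in> M \<Longrightarrow> norm (R x) \<le> K0 * norm x" using R(1) unfolding bounded_op_on_def by blast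
  define K where "K = max K0 1"
  have K: "K > 0" by (simp add: K_def)
  have RK: "norm (R x) \<le> K * norm x" if "x \<in> M" for x
    using order_trans[OF K0[OF that] mult_right_mono[of K0 K "norm x"]] by (simp add: K_def)
  have bN: "bij_betw (\<lambda>x. S x - w *\<^sub>C x) N N" if "w \<noteq> 0" for w
    using N(3) that quasinilpotent_on_iff_bij[OF N.operator_on_closed_subspace_axioms] by blast
  show thesis
  proof
    show "1 / K > 0" using K by simp
  next
    fix w x assume w: "w \<noteq> 0" "cmod w < 1 / K" and x: "S x = w *\<^sub>C x"
    have wK: "cmod w * K < 1" using w(2) K by (simp add: field_simps)
    obtain a b where ab: "a \<in> M" "b \<in> N" "x = a + b" using MN'(3)[of x] by auto
    have "S a = w *\<^sub>C a \<and> S b = w *\<^sub>C b"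
      by (rule direct_sum_unique[OF M.csubspace N.csubspace MN'(1)])
        (use ab x M.mem N.mem in \<open>auto simp: M.lin scaleC_add_right complex_vector.subspace_scale M.csubspace N.csubspace\<close>)
    then have Sa: "S a = w *\<^sub>C a" and Sb: "S b = w *\<^sub>C b" by auto
    have "b = 0"
    proof (rule inj_onD[OF bij_betw_imp_inj_on[OF bN[OF w(1)]]])
      show "S b - w *\<^sub>C b = S 0 - w *\<^sub>C 0" using Sb by (simp add: M.lin)
    qed (use ab complex_vector.subspace_0[OF N.csubspace] in auto)
    moreover have "a = 0"
    proof (rule ccontr)
      assume "a \<noteq> 0"
      have "norm a = norm (R (w *\<^sub>C a))" using R(2)[OF ab(1)] Sa by simp
      also have "\<dots> \<le> K * norm (w *\<^sub>C a)" by (intro RK complex_vector.subspace_scale[OF M.csubspace] ab)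
      also have "\<dots> = (cmod w * K) * norm a" by (simp add: norm_scaleC)
      also have "\<dots> < 1 * norm a" using wK \<open>a \<noteq> 0\<close> by (intro mult_strict_right_mono) auto
      finally show False by simp
    qed
    ultimately show "x = 0" using ab by simp
  next
    fix w and \<phi> :: "'a cdual"
    assume w: "w \<noteq> 0" "cmod w < 1 / K" and \<phi>: "\<And>x. cblinfun_apply \<phi> (S x) = w * cblinfun_apply \<phi> x"
    have wK: "cmod w * K < 1" using w(2) K by (simp add: field_simps)
    note \<phi>lin = clinear_simps[OF clinear_cblinfun_apply[of \<phi>]]
    have onN: "\<phi> y = 0" if "y \<in> N" for y
    proof -
      have "y \<in> (\<lambda>x. S x - w *\<^sub>C x) ` N" using bij_betw_imp_surj_on[OF bN[OF w(1)]] that by simp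
      then obtain x where "x \<in> N" "y = S x - w *\<^sub>C x" by blast
      then show ?thesis by (simp add: \<phi>lin \<phi> scaleC_complex_def)
    qed
    have le: "cmod (\<phi> y) \<le> (cmod w * K) ^ n * (norm \<phi> * norm y)" if "y \<in> M" for y n
      using that
    proof (induction n arbitrary: y)
      case 0
      then show ?case using norm_cblinfun_apply[of \<phi> y] by simp
    next
      case (Suc n)
      have "cmod (\<phi> y) = cmod w * cmod (\<phi> (R y))" using \<phi>[of "R y"] R(3)[OF Suc.prems] by (simp add: norm_mult)
      also have "\<dots> \<le> cmod w * ((cmod w * K) ^ n * (norm \<phi> * norm (R y)))"
        by (intro mult_left_mono Suc.IH RM Suc.prems) simp
      also have "\<dots> \<le> cmod w * ((cmod w * K) ^ n * (norm \<phi> * (K * norm y)))"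
        using K by (intro mult_left_mono RK Suc.prems) auto
      finally show ?case by (simp add: mult_ac)
    qed
    have onM: "\<phi> y = 0" if "y \<in> M" for y
    proof -
      have "(\<lambda>n. (cmod w * K) ^ n * (norm \<phi> * norm y)) \<longlonglongrightarrow> 0"
        using wK K by (intro tendsto_mult_left_zero LIMSEQ_realpow_zero) auto
      then have "cmod (\<phi> y) \<le> 0" by (rule LIMSEQ_le_const) (use le[OF that] in blast)
      then show ?thesis by simp
    qed
    show "\<phi> = 0"
    proof (rule cblinfun_eqI)
      fix x
      obtain a b where "a \<in> M" "b \<in> N" "x = a + b" using MN'(3)[of x] by auto
      then have "\<phi> x = 0" using onM onN by (simp add: \<phi>lin)
      moreover have "cblinfun_apply (0 :: 'a cdual) x = 0" by transfer simp
      ultimately show "\<phi> x = cblinfun_apply 0 x" by simp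
    qed
  qed
qed

lemma SVEP_at_if_no_eigenvalues_nearby:
  fixes T :: "'a::complex_banach \<Rightarrow>\<^sub>\<complex> 'a"
  assumes e: "e > 0" and inj: "\<And>w x. w \<noteq> z \<Longrightarrow> dist z w < e \<Longrightarrow> T x = w *\<^sub>C x \<Longrightarrow> x = 0"
  shows "SVEP_at T z"
  unfolding SVEP_at_def
proof (intro allI impI ballI, elim conjE)
  fix U f v
  assume U: "open U" "connected U" "z \<in> U" and f: "vector_analytic_on f U"
    and eig: "\<forall>w\<in>U. cblinfun_apply (T - w *\<^sub>C id_cblinfun) (f w) = 0" and v: "v \<in> U"
  have zero: "f w = 0" if "w \<in> U" "w \<noteq> z" "dist z w < e" for w
    using inj[OF that(2,3)] eig that(1) by (simp add: cblinfun_apply_minus_scaleC_id)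
  have "\<forall>\<^sub>F w in at z. w \<in> U" using U by (intro eventually_at_in_open') auto
  moreover have "\<forall>\<^sub>F w in at z. w \<noteq> z \<and> dist z w < e"
    unfolding eventually_at using e by (auto simp: dist_commute)
  ultimately have "\<forall>\<^sub>F w in at z. f w = 0" by eventually_elim (use zero in blast)
  then show "f v = 0" by (rule vector_analytic_identity[OF f U _ v])
qed

theorem SVEP_at_if_generalized_Drazin:
  fixes T :: "'a::complex_banach \<Rightarrow>\<^sub>\<complex> 'a"
  assumes "generalized_Drazin_invertible (T - z *\<^sub>C id_cblinfun)"
  shows "SVEP_at T z" and "SVEP_at (cdual_op T) z"
proof -
  let ?S = "T - z *\<^sub>C id_cblinfun"
  obtain e where e: "e > 0"
    and inj: "\<And>w x. w \<noteq> 0 \<Longrightarrow> cmod w < e \<Longrightarrow> ?S x = w *\<^sub>C x \<Longrightarrow> x = 0"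
    and dual: "\<And>w \<phi>. w \<noteq> 0 \<Longrightarrow> cmod w < e \<Longrightarrow> (\<And>x. cblinfun_apply \<phi> (?S x) = w * cblinfun_apply \<phi> x)
      \<Longrightarrow> \<phi> = (0 :: 'a cdual)"
    using generalized_Drazin_punctured_disc[OF assms] by blast
  show "SVEP_at T z"
  proof (rule SVEP_at_if_no_eigenvalues_nearby[OF e])
    fix w x assume "w \<noteq> z" "dist z w < e" "T x = w *\<^sub>C x"
    then show "x = 0"
      by (intro inj[of "w - z"]) (simp_all add: dist_norm norm_minus_commute
          cblinfun_apply_minus_scaleC_id complex_vector.scale_left_diff_distrib)
  qed
  show "SVEP_at (cdual_op T) z"
  proof (rule SVEP_at_if_no_eigenvalues_nearby[OF e])
    fix w and \<phi> :: "'a cdual" assume w: "w \<noteq> z" "dist z w < e" and \<phi>: "cdual_op T \<phi> = w *\<^sub>C \<phi>"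
    note \<phi>lin = clinear_simps[OF clinear_cblinfun_apply[of \<phi>]]
    have "\<phi> (T x) = w * \<phi> x" for x
    proof -
      have "\<phi> (T x) = cblinfun_apply (w *\<^sub>C \<phi>) x"
        using \<phi> by (simp add: cdual_op_apply flip: cblinfun_compose_apply)
      also have "\<dots> = w *\<^sub>C \<phi> x"
        by transfer (simp add: bounded_linear_Blinfun_apply
            bounded_bilinear.bounded_linear_right[OF bounded_bilinear_scaleC])
      finally show ?thesis by (simp add: scaleC_complex_def)
    qed
    then show "\<phi> = 0"
      using w by (intro dual[of "w - z"]) (simp_all add: dist_norm norm_minus_commute
          cblinfun_apply_minus_scaleC_id \<phi>lin scaleC_complex_def algebra_simps)
  qed
qed

theorem proposition2p5:
  fixes T :: "'a::complex_banach \<Rightarrow>\<^sub>\<complex> 'a"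
  shows "sigma_gD T = sigma_gDW T \<longleftrightarrow>
    (\<forall>z. z \<notin> sigma_gDW T \<longrightarrow> SVEP_at T z \<and> SVEP_at (cdual_op T) z)"
proof
  assume eq: "sigma_gD T = sigma_gDW T"
  show "\<forall>z. z \<notin> sigma_gDW T \<longrightarrow> SVEP_at T z \<and> SVEP_at (cdual_op T) z"
  proof (intro allI impI)
    fix z assume "z \<notin> sigma_gDW T"
    then have "generalized_Drazin_invertible (T - z *\<^sub>C id_cblinfun)"
      unfolding eq[symmetric] by (simp add: sigma_gD_def)
    then show "SVEP_at T z \<and> SVEP_at (cdual_op T) z" using SVEP_at_if_generalized_Drazin by blast
  qed
next
  assume "\<forall>z. z \<notin> sigma_gDW T \<longrightarrow> SVEP_at T z \<and> SVEP_at (cdual_op T) z"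
  then show "sigma_gD T = sigma_gDW T"
    using generalized_Drazin_if_pseudo_B_Weyl_and_SVEP pseudo_B_Weyl_if_generalized_Drazin
    unfolding sigma_gD_def sigma_gDW_def by blast
qed

end
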